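(* For each $s\geqslant 1$, the following decision problem is decidable: given a unitary matrix $A\in \mathrm{U}_s(\mathbb{Q}[i])$, decide whether $\mathrm{tr}(A^n)\in\mathbb{R}_{\geqslant 0}$ for all $n\geqslant 0$ (the moment positivity problem for the instance set $\mathrm{U}_s(\mathbb{Q}[i])$ and $\mathcal P=\mathbb{R}_{\geqslant 0}$).
   Context: $\mathbb{Q}[i]$ is the field of complex numbers with rational real and imaginary parts, and $\mathrm{U}_s(\mathbb{Q}[i])$ is the set of unitary $s\times s$ matrices with entries in $\mathbb{Q}[i]$. For a square matrix $A$, its $n$-th moment is $\mu_n(A)=\mathrm{tr}(A^n)$. Moment positivity problem, for fixed size $s$, fixed set $\mathcal P$ and fixed instance set $\mathcal D$ of $s\times s$ matrices: given $A\in\mathcal D$, decide whether all moments $\mu_n(A)$ belong to $\mathcal P$. It is called decidable if there is an algorithm (which may depend on $s,\mathcal P,\mathcal D$) that, on input any $A\in\mathcal D$, stops after finite time and answers yes if all moments of $A$ belong to $\mathcal P$, and no if at least one does not. *)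

theory Defs
  imports
    "Jordan_Normal_Form.Schur_Decomposition"
    "HOL-Library.Nat_Bijection"
    "HOL-Library.Nonpos_Ints"
begin

section \<open>Partial recursive functions\<close>

datatype recf =
    Zero
  | Succ
  | Proj nat
  | Comp recf "recf list"
  | Prec recf recf
  | Mu recf

text \<open>
  \<open>rec_eval f xs y\<close>: on the arguments \<open>xs\<close>, \<open>f\<close> halts with value \<open>y\<close>. The recursion or search
  variable is the first argument; the step function of \<open>Prec\<close> receives the counter and then the
  previous value. \<open>Mu f\<close> requires \<open>f\<close> to be defined (and nonzero) below the zero it returns.
\<close>

inductive rec_eval :: "recf \<Rightarrow> nat list \<Rightarrow> nat \<Rightarrow> bool" where
  Zero: "rec_eval Zero xs 0"
| Succ: "rec_eval Succ [x] (Suc x)"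
| Proj: "i < length xs \<Longrightarrow> rec_eval (Proj i) xs (xs ! i)"
| Comp: "list_all2 (\<lambda>g y. rec_eval g xs y) gs ys \<Longrightarrow> rec_eval f ys z
    \<Longrightarrow> rec_eval (Comp f gs) xs z"
| Prec_0: "rec_eval f xs y \<Longrightarrow> rec_eval (Prec f g) (0 # xs) y"
| Prec_Suc: "rec_eval (Prec f g) (n # xs) y \<Longrightarrow> rec_eval g (n # y # xs) z
    \<Longrightarrow> rec_eval (Prec f g) (Suc n # xs) z"
| Mu: "rec_eval f (n # xs) 0 \<Longrightarrow> \<forall>m<n. \<exists>y. rec_eval f (m # xs) (Suc y)
    \<Longrightarrow> rec_eval (Mu f) xs n"

inductive_cases rec_eval_ZeroE: "rec_eval Zero xs y"
inductive_cases rec_eval_SuccE: "rec_eval Succ xs y"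
inductive_cases rec_eval_ProjE: "rec_eval (Proj i) xs y"
inductive_cases rec_eval_CompE: "rec_eval (Comp f gs) xs y"
inductive_cases rec_eval_Prec_0E: "rec_eval (Prec f g) (0 # xs) y"
inductive_cases rec_eval_Prec_SucE: "rec_eval (Prec f g) (Suc n # xs) y"
inductive_cases rec_eval_MuE: "rec_eval (Mu f) xs y"

lemma rec_eval_deterministic:
  "rec_eval f xs y \<Longrightarrow> rec_eval f xs z \<Longrightarrow> y = z"
proof (induction arbitrary: z rule: rec_eval.induct)
  case (Zero xs)
  then show ?case by (rule rec_eval_ZeroE) simp
next
  case (Succ x)
  then show ?case by (rule rec_eval_SuccE) simp
next
  case (Proj i xs)
  from Proj.prems show ?case by (rule rec_eval_ProjE) simp
next
  case (Prec_0 f xs y g)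
  from Prec_0.prems have "rec_eval f xs z" by (rule rec_eval_Prec_0E)
  then show ?case by (rule Prec_0.IH)
next
  case (Comp xs gs ys f w)
  from Comp.prems obtain ys' where ys': "list_all2 (\<lambda>g y. rec_eval g xs y) gs ys'"
    and w: "rec_eval f ys' z" by (auto elim: rec_eval_CompE)
  have "ys = ys'"
    using Comp.IH(1) ys' by (auto simp: list_all2_conv_all_nth intro: nth_equalityI)
  then show ?case using Comp.IH(2) w by blast
next
  case (Prec_Suc f g n xs y w)
  from Prec_Suc.prems obtain y' where "rec_eval (Prec f g) (n # xs) y'"
    and "rec_eval g (n # y' # xs) z" by (auto elim: rec_eval_Prec_SucE)
  then show ?case using Prec_Suc.IH by blast
next
  case (Mu f n xs)
  from Mu.prems have z: "rec_eval f (z # xs) 0"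
    and zlt: "\<forall>m<z. \<exists>y. rec_eval f (m # xs) (Suc y)" by (auto elim: rec_eval_MuE)
  show ?case
  proof (rule linorder_cases[of n z])
    assume "n < z"
    then obtain y where "rec_eval f (n # xs) (Suc y)" using zlt by blast
    then show ?thesis using Mu.IH(1) by fastforce
  next
    assume "z < n"
    then obtain y where "\<And>v. rec_eval f (z # xs) v \<Longrightarrow> Suc y = v" using Mu.IH(2) by blast
    then show ?thesis using z by fastforce
  qed
qed

text \<open>
  Decidability of \<open>P\<close> on the instance set \<open>D\<close>, where an instance \<open>a\<close> is presented as the tuple
  \<open>enc a\<close>. Nothing is required of the algorithm on inputs that do not encode an element of \<open>D\<close>.
\<close>

definition decidable_on :: "('a \<Rightarrow> nat list) \<Rightarrow> 'a set \<Rightarrow> ('a \<Rightarrow> bool) \<Rightarrow> bool" where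
  "decidable_on enc D P \<longleftrightarrow>
    (\<exists>f. \<forall>a\<in>D. rec_eval f (enc a) (if P a then 1 else 0))"


section \<open>Matrices over the Gaussian rationals\<close>

definition gaussian_rationals :: "complex set" where
  "gaussian_rationals = {z. Re z \<in> \<rat> \<and> Im z \<in> \<rat>}"

definition unitary_mat :: "complex mat \<Rightarrow> bool" where
  "unitary_mat A \<longleftrightarrow> square_mat A \<and>
    A * mat_adjoint A = 1\<^sub>m (dim_row A) \<and> mat_adjoint A * A = 1\<^sub>m (dim_row A)"

definition unitary_gaussian :: "nat \<Rightarrow> complex mat set" where
  "unitary_gaussian s =
    {A \<in> carrier_mat s s. unitary_mat A \<and> elements_mat A \<subseteq> gaussian_rationals}"

text \<open>
  A rational is given by numerator and (positive) denominator in lowest terms, a Gaussian rational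
  by its real and imaginary part, and a matrix by its entries, row by row. An \<open>s \<times> s\<close> matrix
  thus becomes a tuple of \<open>4 * s\<^sup>2\<close> natural numbers. The encoding is meaningful only for rational,
  respectively Gaussian rational, arguments.
\<close>

definition encode_rational :: "real \<Rightarrow> nat list" where
  "encode_rational x =
    (case quotient_of (inv_into UNIV of_rat x) of (p, q) \<Rightarrow> [int_encode p, nat q])"

definition encode_gaussian :: "complex \<Rightarrow> nat list" where
  "encode_gaussian z = encode_rational (Re z) @ encode_rational (Im z)"

definition encode_mat :: "complex mat \<Rightarrow> nat list" where
  "encode_mat A = concat (map encode_gaussian (concat (mat_to_list A)))"

lemma encode_rational_of_rat:
  "encode_rational (of_rat r) = [int_encode (fst (quotient_of r)), nat (snd (quotient_of r))]"
proof -
  have "inj (of_rat :: rat \<Rightarrow> real)" by (simp add: inj_def)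
  then show ?thesis by (simp add: encode_rational_def split_beta)
qed

lemma inj_on_encode_rational: "inj_on encode_rational \<rat>"
proof (rule inj_onI)
  fix x y :: real
  assume "x \<in> \<rat>" "y \<in> \<rat>" and eq: "encode_rational x = encode_rational y"
  then obtain a b where xy: "x = of_rat a" "y = of_rat b" by (auto elim!: Rats_cases)
  have "quotient_of a = quotient_of b"
    using eq quotient_of_denom_pos'[of a] quotient_of_denom_pos'[of b]
    by (simp add: xy encode_rational_of_rat int_encode_eq prod_eq_iff eq_nat_nat_iff)
  then show "x = y" using xy quotient_of_inject by simp
qed

lemma length_encode_gaussian: "length (encode_gaussian z) = 4"
  by (simp add: encode_gaussian_def encode_rational_def split_beta)

lemma inj_on_encode_gaussian: "inj_on encode_gaussian gaussian_rationals"
proof (rule inj_onI)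
  fix x y
  assume "x \<in> gaussian_rationals" "y \<in> gaussian_rationals"
    and "encode_gaussian x = encode_gaussian y"
  moreover have "length (encode_rational u) = length (encode_rational v)" for u v
    by (simp add: encode_rational_def split_beta)
  ultimately show "x = y"
    by (auto simp: encode_gaussian_def gaussian_rationals_def complex_eq_iff
        intro: inj_onD[OF inj_on_encode_rational])
qed

lemma concat_map_encode_gaussian_inject:
  assumes "concat (map encode_gaussian xs) = concat (map encode_gaussian ys)"
    and "set xs \<subseteq> gaussian_rationals" "set ys \<subseteq> gaussian_rationals"
  shows "xs = ys"
  using assms
proof (induction xs arbitrary: ys)
  case Nil
  then show ?case using length_encode_gaussian[of "hd ys"] by (cases ys) auto
next
  case (Cons x xs)
  then obtain y ys' where ys: "ys = y # ys'"
    using length_encode_gaussian[of x] by (cases ys) auto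
  with Cons.prems have "encode_gaussian x = encode_gaussian y"
    and "concat (map encode_gaussian xs) = concat (map encode_gaussian ys')"
    by (simp_all add: length_encode_gaussian append_eq_append_conv)
  then show ?case
    using Cons ys inj_onD[OF inj_on_encode_gaussian] by auto
qed

lemma inj_on_encode_mat:
  "inj_on encode_mat {A \<in> carrier_mat s s. elements_mat A \<subseteq> gaussian_rationals}"
proof (rule inj_onI)
  fix A B :: "complex mat"
  assume A: "A \<in> {A \<in> carrier_mat s s. elements_mat A \<subseteq> gaussian_rationals}"
    and B: "B \<in> {A \<in> carrier_mat s s. elements_mat A \<subseteq> gaussian_rationals}"
    and eq: "encode_mat A = encode_mat B"
  have set: "set (concat (mat_to_list M)) = elements_mat M" for M :: "complex mat"
    by (auto simp: mat_to_list_def elements_mat_def)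
  have cc: "concat (mat_to_list A) = concat (mat_to_list B)"
    using A B eq unfolding encode_mat_def
    by (intro concat_map_encode_gaussian_inject) (auto simp only: set mem_Collect_eq)
  have "mat_to_list A = mat_to_list B"
    by (rule concat_injective[OF cc])
      (use A B in \<open>auto simp: mat_to_list_def zip_map1 zip_map2 zip_same_conv_map\<close>)
  then have *: "mat_to_list A ! i ! j = mat_to_list B ! i ! j" for i j by simp
  show "A = B"
  proof (rule eq_matI)
    fix i j assume "i < dim_row B" "j < dim_col B"
    then show "A $$ (i, j) = B $$ (i, j)"
      using A B *[of i j] by (auto simp: mat_to_list_def)
  qed (use A B in auto)
qed


section \<open>The moment positivity problem\<close>

definition mat_trace :: "complex mat \<Rightarrow> complex" where
  "mat_trace A = (\<Sum>i<dim_row A. A $$ (i, i))"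

definition moment :: "nat \<Rightarrow> complex mat \<Rightarrow> complex" where
  "moment n A = mat_trace (A ^\<^sub>m n)"

text \<open>The instance set \<open>D\<close> is meant to consist of matrices over the Gaussian rationals.\<close>

definition moment_positivity_decidable :: "complex set \<Rightarrow> complex mat set \<Rightarrow> bool" where
  "moment_positivity_decidable P D \<longleftrightarrow>
    decidable_on encode_mat D (\<lambda>A. \<forall>n. moment n A \<in> P)"

end

theory Submission
  imports Defs "HOL-Analysis.Analysis"
begin

text \<open>
  A unitary matrix of size \<open>s\<close> has eigenvalues \<open>z = (z\<^sub>0, \<dots>, z\<^sub>s\<^sub>-\<^sub>1)\<close> on the unit circle, and its
  moments are the power sums of \<open>z\<close>. So the question is whether \<open>z\<close> lies in the set \<open>G\<close> of those
  points of the torus whose power sums are all nonnegative reals. The size is fixed, and the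
  algorithm may depend on it; the point is that \<open>G\<close> is then described by a single polynomial with
  integer coefficients, so that the algorithm just evaluates this polynomial and compares the value
  with zero. No computation with algebraic numbers and no search for multiplicative relations
  between the eigenvalues is involved.

  The set \<open>G\<close> is topologically closed, and it contains with \<open>z\<close> all powers of \<open>z\<close>. Every such set
  is a finite union of closed subgroups, each cut out by finitely many equations \<open>z\<^sup>m = 1\<close>
  (\<open>closed_power_closed_finite_union\<close>). Two facts enter. The first is a uniform Kronecker
  theorem (\<open>simultaneous_approximation\<close>): for each \<open>d\<close> there are finitely many exponents such that,
  for all points \<open>z\<close> and \<open>w\<close> of the torus, if \<open>w\<close> satisfies those equations among \<open>z\<^sup>m = 1\<close> for
  these exponents that \<open>z\<close> satisfies, then some power of \<open>z\<close> is \<open>d\<close>-close to \<open>w\<close>. Hence if a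
  subgroup \<open>H\<close> is not contained in \<open>G\<close>, say \<open>w \<in> H - G\<close>, then each \<open>z \<in> G\<close> satisfies one of finitely
  many further equations that \<open>w\<close> violates, and \<open>G \<inter> H\<close> is covered by finitely many strictly
  smaller subgroups. The second fact is that the exponents form a Noetherian group
  (\<open>annihilated_chain_stabilizes\<close>), so this process ends.

  Consequently \<open>G\<close> is the zero set of \<open>r(z) = \<Prod>\<^sub>M \<Sum>\<^sub>m\<^sub>\<in>\<^sub>M |z\<^sup>m - 1|\<^sup>2\<close>, which on the torus is a Laurent
  polynomial with integer coefficients. Since \<open>r\<close> is nonnegative and \<open>G\<close> is invariant under
  permutations of the coordinates, the sum of \<open>r\<close> over all permutations of the coordinates has the
  same zeros. This sum is symmetric, hence an integer polynomial in the power sums with positive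
  and negative exponents (\<open>computable_symmetrization\<close>), that is, in the moments of the matrix and
  their complex conjugates. These are obtained from the entries by rational arithmetic, which is
  primitive recursive.
\<close>


section \<open>Characters of the torus\<close>

definition torus :: "nat \<Rightarrow> (nat \<Rightarrow> complex) set" where
  "torus s = {z. \<forall>j<s. norm (z j) = 1}"

definition laurent_monom :: "nat \<Rightarrow> (nat \<Rightarrow> int) \<Rightarrow> (nat \<Rightarrow> complex) \<Rightarrow> complex" where
  "laurent_monom s m z = (\<Prod>j<s. z j powi m j)"

definition annihilated :: "nat \<Rightarrow> (nat \<Rightarrow> int) set \<Rightarrow> (nat \<Rightarrow> complex) set" where
  "annihilated s M = {z \<in> torus s. \<forall>m\<in>M. laurent_monom s m z = 1}"

lemma torus_nonzero: "z \<in> torus s \<Longrightarrow> j < s \<Longrightarrow> z j \<noteq> 0"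
  by (auto simp: torus_def)

lemma norm_laurent_monom: "z \<in> torus s \<Longrightarrow> norm (laurent_monom s m z) = 1"
  by (simp add: laurent_monom_def torus_def prod_norm[symmetric] norm_power_int)

lemma laurent_monom_add:
  "z \<in> torus s \<Longrightarrow> laurent_monom s (\<lambda>j. m j + m' j) z = laurent_monom s m z * laurent_monom s m' z"
proof -
  assume "z \<in> torus s"
  then have "z j powi (m j + m' j) = z j powi m j * z j powi m' j" if "j < s" for j
    using torus_nonzero[of z s j] that by (simp add: power_int_add)
  then show ?thesis by (simp add: laurent_monom_def prod.distrib)
qed

lemma laurent_monom_uminus:
  "laurent_monom s (\<lambda>j. - m j) z = inverse (laurent_monom s m z)"
  unfolding laurent_monom_def power_int_minus by (induction s) auto

lemma laurent_monom_diff: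
  "z \<in> torus s \<Longrightarrow> laurent_monom s (\<lambda>j. m j - m' j) z = laurent_monom s m z / laurent_monom s m' z"
  using laurent_monom_add[of z s m "\<lambda>j. - m' j"] by (simp add: laurent_monom_uminus divide_inverse)

lemma laurent_monom_power:
  "laurent_monom s m (\<lambda>j. z j ^ n) = laurent_monom s m z ^ n"
proof -
  have "(z j ^ n) powi m j = (z j powi m j) ^ n" for j
    by (metis mult.commute power_int_mult power_int_of_nat)
  then show ?thesis by (simp add: laurent_monom_def prod_power_distrib)
qed

lemma laurent_monom_divide:
  "laurent_monom s m (\<lambda>j. z j / w j) = laurent_monom s m z / laurent_monom s m w"
  by (simp add: laurent_monom_def power_int_divide_distrib prod_dividef)

lemma cnj_laurent_monom:
  "z \<in> torus s \<Longrightarrow> cnj (laurent_monom s m z) = laurent_monom s (\<lambda>j. - m j) z"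
  unfolding laurent_monom_uminus using norm_laurent_monom[of z s m]
  by (metis complex_norm_square inverse_unique mult.commute of_real_1 one_power2)

lemma torus_power: "z \<in> torus s \<Longrightarrow> (\<lambda>j. z j ^ n) \<in> torus s"
  by (simp add: torus_def norm_power)


section \<open>Approximating points of the torus by powers\<close>

text \<open>
  Geometric sums stay bounded unless \<open>u = 1\<close>. Hence averaging a character over the powers of a point
  detects whether the character is trivial at this point.
\<close>

lemma mean_powers_tendsto:
  fixes u :: complex
  assumes "norm u = 1"
  shows "(\<lambda>N. (\<Sum>n<N. u ^ n) / of_nat N) \<longlonglongrightarrow> (if u = 1 then 1 else 0)"
proof (cases "u = 1")
  case True
  have "(\<lambda>N. (\<Sum>n<N. u ^ n) / of_nat N) \<longlonglongrightarrow> 1"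
    by (rule tendsto_eventually) (auto simp: True eventually_at_top_linorder intro!: exI[of _ 1])
  then show ?thesis using True by simp
next
  case False
  have "(\<lambda>N. norm ((\<Sum>n<N. u ^ n) / of_nat N)) \<longlonglongrightarrow> 0"
  proof (rule tendsto_sandwich[OF _ _ tendsto_const])
    show "\<forall>\<^sub>F N in sequentially. norm ((\<Sum>n<N. u ^ n) / of_nat N) \<le> 2 / norm (u - 1) / real N"
    proof (rule always_eventually, rule allI)
      fix N
      have "norm (u ^ N - 1) \<le> 2"
        using norm_triangle_ineq4[of "u ^ N" 1] assms by (simp add: norm_power)
      then have "norm (u ^ N - 1) / norm (u - 1) / real N \<le> 2 / norm (u - 1) / real N"
        by (intro divide_right_mono) auto
      moreover have "norm ((\<Sum>n<N. u ^ n) / of_nat N) = norm (u ^ N - 1) / norm (u - 1) / real N"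
        unfolding geometric_sum[OF False] norm_divide norm_of_nat by (rule refl)
      ultimately show "norm ((\<Sum>n<N. u ^ n) / of_nat N) \<le> 2 / norm (u - 1) / real N"
        by simp
    qed
    show "(\<lambda>N. 2 / norm (u - 1) / real N) \<longlonglongrightarrow> 0"
      by (rule lim_const_over_n)
  qed auto
  then show ?thesis using False by (simp add: tendsto_norm_zero_iff)
qed

text \<open>Taking an \<open>(s+1)\<close>-st root of \<open>q\<close> reduces the claim to the linear case \<open>s = 1\<close>.\<close>

lemma power_times_geometric_small:
  fixes q :: real
  assumes "0 \<le> q" "q < 1"
  shows "\<exists>K. (real K + 1) ^ s * q ^ K < 1"
proof (cases "q = 0")
  case True
  then show ?thesis by (intro exI[of _ 1]) simp
next
  case False
  define r where "r = root (Suc s) q"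
  have r: "0 < r" "r < 1" "r ^ Suc s = q"
    using assms False real_root_pow_pos2[of "Suc s" q] unfolding r_def by auto
  have "(\<lambda>n. real n * r ^ n + r ^ n) \<longlonglongrightarrow> 0 + 0"
    by (intro tendsto_add powser_times_n_limit_0 LIMSEQ_power_zero) (use r in auto)
  then have "(\<lambda>n. (real n + 1) * r ^ n) \<longlonglongrightarrow> 0"
    by (simp only: distrib_right mult_1 add_0)
  then have "eventually (\<lambda>n. (real n + 1) * r ^ n < 1) sequentially"
    by (rule order_tendstoD) simp
  then obtain K where K: "(real K + 1) * r ^ K < 1"
    by (auto simp: eventually_at_top_linorder)
  have "q ^ K = (r ^ K) ^ Suc s"
    by (metis mult.commute power_mult r(3))
  moreover have "(real K + 1) ^ s \<le> (real K + 1) ^ Suc s"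
    by (rule power_increasing) auto
  ultimately have "(real K + 1) ^ s * q ^ K \<le> ((real K + 1) * r ^ K) ^ Suc s"
    using r(1) by (simp only: power_mult_distrib) (intro mult_right_mono, auto)
  also have "\<dots> < 1" using K r by (intro power_Suc_less_one) auto
  finally show ?thesis by blast
qed

lemma half_one_plus_norm:
  fixes y :: complex
  assumes "norm y = 1"
  shows "(norm ((1 + y) / 2))\<^sup>2 = 1 - (norm (y - 1))\<^sup>2 / 4"
proof -
  have "(Re y)\<^sup>2 + (Im y)\<^sup>2 = 1" using assms by (simp flip: cmod_power2)
  then have "(norm (1 + y))\<^sup>2 + (norm (y - 1))\<^sup>2 = 4"
    unfolding cmod_power2 by (simp add: power2_eq_square algebra_simps)
  then show ?thesis by (simp add: norm_divide power_divide)
qed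

text \<open>
  A product of powers of \<open>(1 + y\<^sub>j) / 2\<close>: on the torus it is exponentially small in \<open>K\<close> away from
  the point \<open>(1, \<dots>, 1)\<close>, whereas the sum of the squares of its coefficients decays only
  polynomially.
\<close>

definition binomial_kernel :: "nat \<Rightarrow> nat \<Rightarrow> (nat \<Rightarrow> complex) \<Rightarrow> complex" where
  "binomial_kernel s K y = (\<Prod>j<s. ((1 + y j) / 2) ^ K)"

definition binomial_coeff :: "nat \<Rightarrow> nat \<Rightarrow> (nat \<Rightarrow> nat) \<Rightarrow> real" where
  "binomial_coeff s K g = (\<Prod>j<s. real (K choose g j) / 2 ^ K)"

lemma binomial_kernel_expand:
  "binomial_kernel s K y =
    (\<Sum>g\<in>PiE {..<s} (\<lambda>_. {..K}). of_real (binomial_coeff s K g) * laurent_monom s (\<lambda>j. int (g j)) y)"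
proof -
  have "((1 + y j) / 2) ^ K = (\<Sum>k\<le>K. of_nat (K choose k) / 2 ^ K * y j ^ k)" for j
    using binomial_ring[of "y j" 1 K]
    by (simp add: power_divide add.commute sum_divide_distrib)
  then have "binomial_kernel s K y = (\<Prod>j<s. \<Sum>k\<le>K. of_nat (K choose k) / 2 ^ K * y j ^ k)"
    by (simp add: binomial_kernel_def)
  also have "\<dots> = (\<Sum>g\<in>PiE {..<s} (\<lambda>_. {..K}). \<Prod>j<s. of_nat (K choose g j) / 2 ^ K * y j ^ g j)"
    by (rule prod_sum_PiE) auto
  finally show ?thesis
    by (simp add: binomial_coeff_def laurent_monom_def flip: prod.distrib)
qed

lemma sum_binomial_coeff: "(\<Sum>g\<in>PiE {..<s} (\<lambda>_. {..K}). binomial_coeff s K g) = 1"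
proof -
  have "complex_of_real (\<Sum>g\<in>PiE {..<s} (\<lambda>_. {..K}). binomial_coeff s K g) = 1"
    using binomial_kernel_expand[of s K "\<lambda>_. 1"]
    by (simp add: binomial_kernel_def laurent_monom_def)
  then show ?thesis by (simp only: of_real_eq_1_iff)
qed

lemma binomial_coeff_nonneg: "binomial_coeff s K g \<ge> 0"
  by (simp add: binomial_coeff_def prod_nonneg)

text \<open>By Cauchy--Schwarz, because the \<open>(K + 1)\<^sup>s\<close> coefficients add up to \<open>1\<close>.\<close>

lemma sum_squares_binomial_coeff:
  "(\<Sum>g\<in>PiE {..<s} (\<lambda>_. {..K}). (binomial_coeff s K g)\<^sup>2) * (real K + 1) ^ s \<ge> 1"
  using sum_squared_le_sum_of_squares[of "binomial_coeff s K" "PiE {..<s} (\<lambda>_. {..K})"]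
  by (simp add: sum_binomial_coeff card_PiE add.commute)

text \<open>One factor alone is that small, by \<open>half_one_plus_norm\<close>, and the other factors are at most \<open>1\<close>.\<close>

lemma binomial_kernel_norm_le:
  assumes "y \<in> torus s" "j < s" "norm (y j - 1) \<ge> d" "d > 0"
  shows "(norm (binomial_kernel s K y))\<^sup>2 \<le> (1 - d\<^sup>2 / 4) ^ K"
proof -
  have le1: "norm ((1 + y i) / 2) \<le> 1" if "i < s" for i
    using norm_triangle_ineq[of 1 "y i"] assms(1) that by (simp add: torus_def norm_divide)
  have "norm (binomial_kernel s K y) = (\<Prod>i<s. norm ((1 + y i) / 2) ^ K)"
    by (simp add: binomial_kernel_def norm_power flip: prod_norm)
  also have "\<dots> = norm ((1 + y j) / 2) ^ K * (\<Prod>i\<in>{..<s} - {j}. norm ((1 + y i) / 2) ^ K)"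
    using assms(2) by (simp add: prod.remove)
  also have "\<dots> \<le> norm ((1 + y j) / 2) ^ K * 1"
    using le1 by (intro mult_left_mono prod_le_1) (auto intro!: power_le_one)
  finally have "(norm (binomial_kernel s K y))\<^sup>2 \<le> (norm ((1 + y j) / 2) ^ K)\<^sup>2"
    by (intro power_mono) auto
  also have "\<dots> = ((norm ((1 + y j) / 2))\<^sup>2) ^ K"
    by (simp only: power_mult[symmetric] mult.commute)
  also have "\<dots> = (1 - (norm (y j - 1))\<^sup>2 / 4) ^ K"
    using half_one_plus_norm[of "y j"] assms(1,2) by (simp only: torus_def mem_Collect_eq)
  also have "\<dots> \<le> (1 - d\<^sup>2 / 4) ^ K"
  proof (rule power_mono)
    show "1 - (norm (y j - 1))\<^sup>2 / 4 \<le> 1 - d\<^sup>2 / 4"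
      using power_mono[OF assms(3), of 2] assms(4) by simp
    show "0 \<le> 1 - (norm (y j - 1))\<^sup>2 / 4"
      using half_one_plus_norm[of "y j"] assms(1,2) zero_le_power2[of "norm ((1 + y j) / 2)"]
      by (simp add: torus_def)
  qed
  finally show ?thesis .
qed

lemma norm_binomial_kernel_expand:
  assumes "y \<in> torus s"
  shows "of_real ((norm (binomial_kernel s K y))\<^sup>2) =
    (\<Sum>g\<in>PiE {..<s} (\<lambda>_. {..K}). \<Sum>h\<in>PiE {..<s} (\<lambda>_. {..K}).
      of_real (binomial_coeff s K g * binomial_coeff s K h) *
      laurent_monom s (\<lambda>j. int (g j) - int (h j)) y)"
proof -
  have "laurent_monom s (\<lambda>j. int (g j) - int (h j)) y =
      laurent_monom s (\<lambda>j. int (g j)) y * cnj (laurent_monom s (\<lambda>j. int (h j)) y)" for g h :: "nat \<Rightarrow> nat"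
    using assms by (simp add: laurent_monom_diff cnj_laurent_monom laurent_monom_uminus divide_inverse)
  then show ?thesis
    by (simp only: complex_norm_square binomial_kernel_expand cnj_sum sum_product)
      (simp add: mult_ac)
qed

text \<open>
  Suppose that no power of \<open>z\<close> is close to \<open>w\<close>. Then the squared modulus of the kernel at \<open>z\<^sup>n / w\<close>
  is exponentially small for every \<open>n\<close>, and so is its mean over \<open>n\<close>. In this mean only the characters
  with \<open>z\<^sup>m = 1\<close> survive; they are also trivial at \<open>w\<close> by assumption, so that every surviving term is
  nonnegative, and the terms with \<open>m = 0\<close> already contribute the sum of the squared coefficients,
  which is only polynomially small. The choice of \<open>K\<close>, and with it the set of exponents, depends on
  \<open>d\<close> and \<open>s\<close> only.
\<close>

lemma simultaneous_approximation:
  assumes "d > 0"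
  shows "\<exists>S. finite S \<and> (\<forall>z\<in>torus s. \<forall>w\<in>torus s.
    (\<forall>m\<in>S. laurent_monom s m z = 1 \<longrightarrow> laurent_monom s m w = 1) \<longrightarrow>
    (\<exists>n. \<forall>j<s. norm (z j ^ n - w j) < d))"
proof -
  \<comment> \<open>\<open>1 - d\<^sup>2 / 4\<close> is negative when \<open>d > 2\<close>, but no two points of the unit circle are that far apart.\<close>
  define q where "q = max 0 (1 - d\<^sup>2 / 4)"
  have q: "0 \<le> q" "q < 1" using assms by (auto simp: q_def)
  obtain K where K: "(real K + 1) ^ s * q ^ K < 1"
    using power_times_geometric_small[OF q] by blast
  define I where "I = PiE {..<s} (\<lambda>_. {..K})"
  define c where "c = binomial_coeff s K"
  define D where "D g h = (\<lambda>j. int (g j) - int (h j))" for g h :: "nat \<Rightarrow> nat"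
  have "finite I" by (auto simp: I_def intro: finite_PiE)
  have "\<exists>n. \<forall>j<s. norm (z j ^ n - w j) < d"
    if z: "z \<in> torus s" and w: "w \<in> torus s"
      and zw: "\<forall>m\<in>(\<lambda>(g, h). D g h) ` (I \<times> I). laurent_monom s m z = 1 \<longrightarrow> laurent_monom s m w = 1"
    for z w
  proof (rule ccontr)
    assume "\<not> ?thesis"
    then have far: "\<exists>j<s. norm (z j ^ n - w j) \<ge> d" for n by (auto simp: not_less)
    define y where "y n = (\<lambda>j. z j ^ n / w j)" for n
    define F where "F n = (norm (binomial_kernel s K (y n)))\<^sup>2" for n
    have y: "y n \<in> torus s" for n
      using z w by (simp add: y_def torus_def norm_divide norm_power)
    have F_le: "F n \<le> q ^ K" for n
    proof -
      obtain j where j: "j < s" "norm (z j ^ n - w j) \<ge> d" using far by blast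
      have "y n j - 1 = (z j ^ n - w j) / w j"
        using torus_nonzero[OF w j(1)] by (simp add: y_def field_simps)
      then have "norm (y n j - 1) = norm (z j ^ n - w j)"
        using w j(1) by (simp add: torus_def norm_divide)
      then have ge: "d \<le> norm (y n j - 1)" using j(2) by simp
      have "norm (y n j - 1) \<le> 2"
        using norm_triangle_ineq4[of "y n j" 1] y[of n] j(1) by (simp add: torus_def)
      then have "d\<^sup>2 \<le> 2\<^sup>2" using ge assms by (intro power_mono) auto
      then have "q = 1 - d\<^sup>2 / 4" by (simp add: q_def)
      then show ?thesis
        using binomial_kernel_norm_le[OF y j(1) ge assms, of K] by (simp add: F_def)
    qed
    have F_eq: "of_real (F n) = (\<Sum>g\<in>I. \<Sum>h\<in>I. of_real (c g * c h) *
        (laurent_monom s (D g h) z ^ n / laurent_monom s (D g h) w))" for n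
      unfolding F_def norm_binomial_kernel_expand[OF y] I_def c_def D_def
      by (simp add: y_def laurent_monom_divide laurent_monom_power)
    define L where "L = (\<Sum>g\<in>I. \<Sum>h\<in>I. c g * c h * (if laurent_monom s (D g h) z = 1 then 1 else 0))"
    have "(\<lambda>N. \<Sum>g\<in>I. \<Sum>h\<in>I. of_real (c g * c h) / laurent_monom s (D g h) w *
        ((\<Sum>n<N. laurent_monom s (D g h) z ^ n) / of_nat N)) \<longlonglongrightarrow>
      (\<Sum>g\<in>I. \<Sum>h\<in>I. of_real (c g * c h) / laurent_monom s (D g h) w *
        (if laurent_monom s (D g h) z = 1 then 1 else 0))"
      by (intro tendsto_sum tendsto_mult tendsto_const mean_powers_tendsto norm_laurent_monom z)
    also have "(\<lambda>N. \<Sum>g\<in>I. \<Sum>h\<in>I. of_real (c g * c h) / laurent_monom s (D g h) w *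
        ((\<Sum>n<N. laurent_monom s (D g h) z ^ n) / of_nat N)) =
      (\<lambda>N. of_real ((\<Sum>n<N. F n) / real N))"
    proof
      fix N
      have "of_real (\<Sum>n<N. F n) = (\<Sum>g\<in>I. \<Sum>h\<in>I. \<Sum>n<N. of_real (c g * c h) *
          (laurent_monom s (D g h) z ^ n / laurent_monom s (D g h) w))"
        unfolding of_real_sum F_eq
        by (subst sum.swap, intro sum.cong refl, subst sum.swap, rule refl)
      then have "of_real ((\<Sum>n<N. F n) / real N) = (\<Sum>g\<in>I. \<Sum>h\<in>I. \<Sum>n<N. of_real (c g * c h) *
          (laurent_monom s (D g h) z ^ n / laurent_monom s (D g h) w)) / of_nat N"
        by (simp only: of_real_divide of_real_of_nat_eq)
      then show "(\<Sum>g\<in>I. \<Sum>h\<in>I. of_real (c g * c h) / laurent_monom s (D g h) w *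
          ((\<Sum>n<N. laurent_monom s (D g h) z ^ n) / of_nat N)) = of_real ((\<Sum>n<N. F n) / real N)"
        by (simp only: sum_divide_distrib sum_distrib_left) simp
    qed
    also have "(\<Sum>g\<in>I. \<Sum>h\<in>I. of_real (c g * c h) / laurent_monom s (D g h) w *
        (if laurent_monom s (D g h) z = 1 then 1 else 0)) = of_real L"
      unfolding L_def of_real_sum using zw by (intro sum.cong refl) auto
    finally have "(\<lambda>N. (\<Sum>n<N. F n) / real N) \<longlonglongrightarrow> L"
      by (simp only: tendsto_of_real_iff)
    moreover have "(\<Sum>n<N. F n) / real N \<le> q ^ K" for N
    proof (cases "N = 0")
      case False
      have "(\<Sum>n<N. F n) \<le> real N * q ^ K"
        using sum_bounded_above[of "{..<N}" F "q ^ K"] F_le by simp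
      then show ?thesis using False by (simp add: field_simps)
    qed (use q in simp)
    ultimately have L_le: "L \<le> q ^ K" by (intro LIMSEQ_le_const2) auto
    \<comment> \<open>Keep only the diagonal terms, whose exponent is \<open>0\<close>.\<close>
    have "(\<Sum>g\<in>I. (c g)\<^sup>2) \<le> L"
      unfolding L_def
    proof (rule sum_mono)
      fix g assume g: "g \<in> I"
      have "laurent_monom s (D g g) z = 1" by (simp add: D_def laurent_monom_def)
      then have "(c g)\<^sup>2 = c g * c g * (if laurent_monom s (D g g) z = 1 then 1 else 0)"
        by (simp add: power2_eq_square)
      also have "\<dots> \<le> (\<Sum>h\<in>I. c g * c h * (if laurent_monom s (D g h) z = 1 then 1 else 0))"
        using \<open>finite I\<close> g
        by (intro member_le_sum[where f = "\<lambda>h. c g * c h * (if laurent_monom s (D g h) z = 1 then 1 else 0)"])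
          (auto simp: c_def binomial_coeff_nonneg)
      finally show "(c g)\<^sup>2 \<le> (\<Sum>h\<in>I. c g * c h * (if laurent_monom s (D g h) z = 1 then 1 else 0))" .
    qed
    then have "(\<Sum>g\<in>I. (c g)\<^sup>2) * (real K + 1) ^ s \<le> q ^ K * (real K + 1) ^ s"
      using L_le by (intro mult_right_mono) auto
    moreover have "1 \<le> (\<Sum>g\<in>I. (c g)\<^sup>2) * (real K + 1) ^ s"
      unfolding I_def c_def by (rule sum_squares_binomial_coeff)
    moreover have "q ^ K * (real K + 1) ^ s < 1" using K by (simp only: mult.commute)
    ultimately show False by linarith
  qed
  then show ?thesis using \<open>finite I\<close>
    by (intro exI[of _ "(\<lambda>(g, h). D g h) ` (I \<times> I)"]) blast
qed


section \<open>Closed sets that contain all powers of their points\<close>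

text \<open>Subgroups of \<open>\<int>\<^sup>s\<close>. Exponents are functions on all of \<open>nat\<close>; only their values below \<open>s\<close> matter.\<close>

definition exponent_group :: "(nat \<Rightarrow> int) set \<Rightarrow> bool" where
  "exponent_group \<Lambda> \<longleftrightarrow> (\<lambda>_. 0) \<in> \<Lambda> \<and> (\<forall>m\<in>\<Lambda>. \<forall>m'\<in>\<Lambda>. (\<lambda>j. m j - m' j) \<in> \<Lambda>)"

lemma exponent_group_diff:
  "exponent_group \<Lambda> \<Longrightarrow> m \<in> \<Lambda> \<Longrightarrow> m' \<in> \<Lambda> \<Longrightarrow> (\<lambda>j. m j - m' j) \<in> \<Lambda>"
  by (simp add: exponent_group_def)

lemma exponent_group_mult:
  assumes "exponent_group \<Lambda>" "m \<in> \<Lambda>"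
  shows "(\<lambda>j. k * m j) \<in> \<Lambda>"
proof -
  have diff: "(\<lambda>j. a j - b j) \<in> \<Lambda>" if "a \<in> \<Lambda>" "b \<in> \<Lambda>" for a b
    using assms(1) that by (rule exponent_group_diff)
  have zero: "(\<lambda>_. 0) \<in> \<Lambda>" using assms(1) by (simp add: exponent_group_def)
  have neg: "(\<lambda>j. - (int n * m j)) \<in> \<Lambda>" for n
  proof (induction n)
    case (Suc n)
    have "(\<lambda>j. - (int (Suc n) * m j)) = (\<lambda>j. - (int n * m j) - m j)"
      by (simp add: fun_eq_iff algebra_simps)
    then show ?case using diff[OF Suc assms(2)] by simp
  qed (use zero in simp)
  show ?thesis
  proof (cases "k \<le> 0")
    case True
    then show ?thesis using neg[of "nat (- k)"] by simp
  next
    case False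
    then show ?thesis using diff[OF zero neg[of "nat k"]] by simp
  qed
qed

lemma laurent_monom_mult:
  "laurent_monom s (\<lambda>j. k * m j) z = laurent_monom s m z powi k"
  unfolding laurent_monom_def mult.commute[of k] power_int_mult
  by (induction s) (auto simp: power_int_mult_distrib)

text \<open>
  Subgroups of \<open>\<int>\<^sup>s\<close> are finitely generated, in the form in which it is needed: the relations in
  \<open>\<Lambda>\<close> follow from finitely many of them. As in the classical proof, an element \<open>b\<close> whose coordinate at
  \<open>t\<close> is positive and minimal divides the coordinate at \<open>t\<close> of every other element, so that
  subtracting multiples of \<open>b\<close> reduces to fewer coordinates.
\<close>

lemma exponent_group_finitely_determined:
  assumes "exponent_group \<Lambda>" "t \<le> s" "\<forall>m\<in>\<Lambda>. \<forall>j. t \<le> j \<and> j < s \<longrightarrow> m j = 0"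
  shows "\<exists>B. finite B \<and> B \<subseteq> \<Lambda> \<and> (\<forall>z\<in>annihilated s B. \<forall>m\<in>\<Lambda>. laurent_monom s m z = 1)"
  using assms
proof (induction t arbitrary: \<Lambda>)
  case 0
  then have "laurent_monom s m z = 1" if "m \<in> \<Lambda>" for m z
    using that by (auto simp: laurent_monom_def intro!: prod.neutral)
  then show ?case by blast
next
  case (Suc t)
  define \<Lambda>' where "\<Lambda>' = {m \<in> \<Lambda>. m t = 0}"
  have "exponent_group \<Lambda>'"
    using Suc.prems(1) by (auto simp: exponent_group_def \<Lambda>'_def)
  moreover have "\<forall>m\<in>\<Lambda>'. \<forall>j. t \<le> j \<and> j < s \<longrightarrow> m j = 0"
  proof (intro ballI allI impI)
    fix m j assume "m \<in> \<Lambda>'" "t \<le> j \<and> j < s"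
    then show "m j = 0" using Suc.prems(3) by (cases "j = t") (auto simp: \<Lambda>'_def)
  qed
  ultimately obtain B where B: "finite B" "B \<subseteq> \<Lambda>'"
      "\<forall>z\<in>annihilated s B. \<forall>m\<in>\<Lambda>'. laurent_monom s m z = 1"
    using Suc.IH[of \<Lambda>'] Suc.prems(2) by auto
  show ?case
  proof (cases "\<Lambda>' = \<Lambda>")
    case True
    then show ?thesis using B by blast
  next
    case False
    then obtain m0 where m0: "m0 \<in> \<Lambda>" "m0 t \<noteq> 0" by (auto simp: \<Lambda>'_def)
    have "(\<lambda>j. sgn (m0 t) * m0 j) \<in> \<Lambda>"
      using Suc.prems(1) m0(1) by (rule exponent_group_mult)
    moreover have "sgn (m0 t) * m0 t = int (nat \<bar>m0 t\<bar>)" by (auto simp: sgn_if)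
    ultimately have ex: "\<exists>d. 0 < d \<and> (\<exists>m\<in>\<Lambda>. m t = int d)"
      using m0(2) by (intro exI[of _ "nat \<bar>m0 t\<bar>"] conjI) (auto intro: bexI[of _ "\<lambda>j. sgn (m0 t) * m0 j"])
    define d where "d = (LEAST d. 0 < d \<and> (\<exists>m\<in>\<Lambda>. m t = int d))"
    have "0 < d \<and> (\<exists>m\<in>\<Lambda>. m t = int d)"
      unfolding d_def by (rule LeastI_ex[OF ex])
    then obtain b where b: "0 < d" "b \<in> \<Lambda>" "b t = int d" by blast
    have min: "d \<le> e" if "0 < e" "m \<in> \<Lambda>" "m t = int e" for e m
      unfolding d_def by (rule Least_le) (use that in blast)
    have rest: "(\<lambda>j. m j - (m t div int d) * b j) \<in> \<Lambda>'" if m: "m \<in> \<Lambda>" for m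
    proof -
      have in_L: "(\<lambda>j. m j - (m t div int d) * b j) \<in> \<Lambda>"
        by (rule exponent_group_diff[OF Suc.prems(1) m exponent_group_mult[OF Suc.prems(1) b(2)]])
      have eq: "m t - (m t div int d) * b t = int (nat (m t mod int d))"
        using b(1,3) by (simp add: minus_div_mult_eq_mod)
      \<comment> \<open>The coordinate at \<open>t\<close> is the remainder modulo \<open>d\<close>; were it positive, it would contradict the minimality of \<open>d\<close>.\<close>
      have "nat (m t mod int d) = 0"
      proof (rule ccontr)
        assume "\<not> ?thesis"
        then have "d \<le> nat (m t mod int d)" using min[OF _ in_L eq] by simp
        moreover have "m t mod int d < int d" using b(1) by simp
        ultimately show False using b(1) by linarith
      qed
      then show ?thesis using in_L eq by (simp add: \<Lambda>'_def)
    qed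
    have "laurent_monom s m z = 1" if z: "z \<in> annihilated s (insert b B)" and m: "m \<in> \<Lambda>" for z m
    proof -
      have zt: "z \<in> torus s" and zb: "laurent_monom s b z = 1" and zB: "z \<in> annihilated s B"
        using z by (auto simp: annihilated_def)
      have "laurent_monom s (\<lambda>j. m j - (m t div int d) * b j) z = 1"
        using B(3) zB rest[OF m] by blast
      then show ?thesis
        using zt zb by (simp add: laurent_monom_diff laurent_monom_mult)
    qed
    then show ?thesis using B(1,2) b(2)
      by (intro exI[of _ "insert b B"]) (auto simp: \<Lambda>'_def)
  qed
qed

text \<open>
  The exponents of all characters that are trivial on \<open>annihilated s (M k)\<close> form an increasing chain
  of groups. The union of the chain is determined by finitely many elements, and these occur at some
  stage.
\<close>

lemma annihilated_chain_stabilizes: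
  assumes "\<And>k. M k \<subseteq> M (Suc k)"
  shows "\<exists>N. \<forall>k. annihilated s (M N) \<subseteq> annihilated s (M k)"
proof -
  define \<Lambda> where "\<Lambda> k = {m. \<forall>z\<in>annihilated s (M k). laurent_monom s m z = 1}" for k
  have mono_M: "M k \<subseteq> M l" if "k \<le> l" for k l
    using assms that by (rule lift_Suc_mono_le)
  have mono: "\<Lambda> k \<subseteq> \<Lambda> l" if "k \<le> l" for k l
    using mono_M[OF that] by (auto simp: \<Lambda>_def annihilated_def)
  have group: "exponent_group (\<Lambda> k)" for k
    unfolding exponent_group_def
  proof (intro conjI ballI)
    show "(\<lambda>_. 0) \<in> \<Lambda> k" by (simp add: \<Lambda>_def laurent_monom_def)
    fix m m' assume "m \<in> \<Lambda> k" "m' \<in> \<Lambda> k"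
    then show "(\<lambda>j. m j - m' j) \<in> \<Lambda> k"
      by (simp add: \<Lambda>_def annihilated_def laurent_monom_diff)
  qed
  have "exponent_group (\<Union>k. \<Lambda> k)"
    unfolding exponent_group_def
  proof (intro conjI ballI)
    show "(\<lambda>_. 0) \<in> (\<Union>k. \<Lambda> k)" using group[of 0] by (auto simp: exponent_group_def)
    fix m m' assume "m \<in> (\<Union>k. \<Lambda> k)" "m' \<in> (\<Union>k. \<Lambda> k)"
    then obtain k l where "m \<in> \<Lambda> k" "m' \<in> \<Lambda> l" by blast
    then have "m \<in> \<Lambda> (max k l)" "m' \<in> \<Lambda> (max k l)"
      using mono[of k "max k l"] mono[of l "max k l"] by auto
    then show "(\<lambda>j. m j - m' j) \<in> (\<Union>k. \<Lambda> k)"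
      using group[of "max k l"] by (auto simp: exponent_group_def)
  qed
  from exponent_group_finitely_determined[OF this order.refl, of s]
  obtain B where B: "finite B" "B \<subseteq> (\<Union>k. \<Lambda> k)"
      "\<forall>z\<in>annihilated s B. \<forall>m\<in>(\<Union>k. \<Lambda> k). laurent_monom s m z = 1"
    by auto
  have "\<exists>N. B \<subseteq> \<Lambda> N"
    using B(1,2)
  proof (induction B rule: finite_induct)
    case (insert b B)
    then obtain N k where "B \<subseteq> \<Lambda> N" "b \<in> \<Lambda> k" by auto
    then have "insert b B \<subseteq> \<Lambda> (max N k)"
      using mono[of N "max N k"] mono[of k "max N k"] by auto
    then show ?case by blast
  qed auto
  then obtain N where N: "B \<subseteq> \<Lambda> N" by blast
  have "annihilated s (M N) \<subseteq> annihilated s (M k)" for k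
  proof
    fix z assume z: "z \<in> annihilated s (M N)"
    then have "z \<in> annihilated s B" using N by (auto simp: annihilated_def \<Lambda>_def)
    moreover have "M k \<subseteq> \<Lambda> k" by (auto simp: \<Lambda>_def annihilated_def)
    ultimately show "z \<in> annihilated s (M k)"
      using B(3) z by (auto simp: annihilated_def)
  qed
  then show ?thesis by blast
qed

text \<open>
  Call a set covered if finitely many of the subgroups contained in \<open>G\<close> cover it. If
  \<open>G \<inter> annihilated s M\<close> is not covered, then the subgroup contains a point \<open>w\<close> outside \<open>G\<close>, and by
  \<open>simultaneous_approximation\<close> finitely many proper subgroups of \<open>annihilated s M\<close> suffice to
  contain \<open>G \<inter> annihilated s M\<close>; one of them has an uncovered intersection with \<open>G\<close>. Starting
  with \<open>M = {}\<close>, this would yield an infinite descending chain of subgroups.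
\<close>

theorem closed_power_closed_finite_union:
  assumes sub: "G \<subseteq> torus s"
    and pow: "\<And>z n. z \<in> G \<Longrightarrow> (\<lambda>j. z j ^ n) \<in> G"
    and closed: "\<And>w. w \<in> torus s \<Longrightarrow> (\<And>d. d > 0 \<Longrightarrow> \<exists>z\<in>G. \<forall>j<s. norm (z j - w j) < d) \<Longrightarrow> w \<in> G"
  shows "\<exists>\<M>. finite \<M> \<and> (\<forall>M\<in>\<M>. finite M) \<and> G = (\<Union>M\<in>\<M>. annihilated s M)"
proof -
  define covered where "covered Y \<longleftrightarrow> (\<exists>\<M>. finite \<M> \<and>
      (\<forall>M\<in>\<M>. finite M \<and> annihilated s M \<subseteq> G) \<and> Y \<subseteq> (\<Union>M\<in>\<M>. annihilated s M))" for Y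
  have covered_Union: "covered (\<Union>i\<in>I. Y i)" if "finite I" "\<And>i. i \<in> I \<Longrightarrow> covered (Y i)" for I Y
    using that
  proof (induction I rule: finite_induct)
    case empty
    show ?case by (auto simp: covered_def intro: exI[of _ "{}"])
  next
    case (insert i I)
    then have "covered (Y i)" "covered (\<Union>i\<in>I. Y i)" by auto
    then obtain M1 M2 where
      "finite M1" "\<forall>M\<in>M1. finite M \<and> annihilated s M \<subseteq> G" "Y i \<subseteq> (\<Union>M\<in>M1. annihilated s M)"
      "finite M2" "\<forall>M\<in>M2. finite M \<and> annihilated s M \<subseteq> G" "(\<Union>i\<in>I. Y i) \<subseteq> (\<Union>M\<in>M2. annihilated s M)"
      unfolding covered_def by blast
    then show ?case unfolding covered_def by (intro exI[of _ "M1 \<union> M2"]) auto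
  qed
  have refine: "\<exists>m. annihilated s (insert m M) \<noteq> annihilated s M \<and> \<not> covered (G \<inter> annihilated s (insert m M))"
    if M: "finite M" "\<not> covered (G \<inter> annihilated s M)" for M
  proof -
    have "\<not> annihilated s M \<subseteq> G"
    proof
      assume "annihilated s M \<subseteq> G"
      then have "covered (G \<inter> annihilated s M)"
        unfolding covered_def using M(1) by (intro exI[of _ "{M}"]) auto
      then show False using M(2) by blast
    qed
    then obtain w where w: "w \<in> annihilated s M" "w \<notin> G" by blast
    then have wt: "w \<in> torus s" by (simp add: annihilated_def)
    from closed[OF this] w(2) obtain d where d: "d > 0" "\<not> (\<exists>z\<in>G. \<forall>j<s. norm (z j - w j) < d)"
      by blast
    obtain S where S: "finite S" "\<And>z w. z \<in> torus s \<Longrightarrow> w \<in> torus s \<Longrightarrow>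
        (\<forall>m\<in>S. laurent_monom s m z = 1 \<longrightarrow> laurent_monom s m w = 1) \<Longrightarrow>
        (\<exists>n. \<forall>j<s. norm (z j ^ n - w j) < d)"
      using simultaneous_approximation[OF d(1), of s] by blast
    have "\<exists>m\<in>S. laurent_monom s m z = 1 \<and> laurent_monom s m w \<noteq> 1" if z: "z \<in> G" for z
    proof (rule ccontr)
      assume "\<not> ?thesis"
      then have "\<forall>m\<in>S. laurent_monom s m z = 1 \<longrightarrow> laurent_monom s m w = 1" by blast
      from S(2)[OF subsetD[OF sub z] wt this]
      obtain n where n: "\<forall>j<s. norm (z j ^ n - w j) < d" ..
      have "\<exists>z\<in>G. \<forall>j<s. norm (z j - w j) < d"
        by (rule bexI[OF _ pow[OF z, of n]]) (rule n)
      then show False using d(2) by contradiction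
    qed
    note separated = this
    have sub_Un: "G \<inter> annihilated s M \<subseteq>
        (\<Union>m\<in>{m\<in>S. laurent_monom s m w \<noteq> 1}. G \<inter> annihilated s (insert m M))"
    proof
      fix z assume z: "z \<in> G \<inter> annihilated s M"
      then obtain m where "m \<in> S" "laurent_monom s m z = 1" "laurent_monom s m w \<noteq> 1"
        using separated[of z] by auto
      then show "z \<in> (\<Union>m\<in>{m\<in>S. laurent_monom s m w \<noteq> 1}. G \<inter> annihilated s (insert m M))"
        using z by (intro UN_I[of m]) (simp_all add: annihilated_def)
    qed
    have "\<not> (\<forall>m\<in>{m\<in>S. laurent_monom s m w \<noteq> 1}. covered (G \<inter> annihilated s (insert m M)))"
    proof
      assume "\<forall>m\<in>{m\<in>S. laurent_monom s m w \<noteq> 1}. covered (G \<inter> annihilated s (insert m M))"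
      then have "covered (\<Union>m\<in>{m\<in>S. laurent_monom s m w \<noteq> 1}. G \<inter> annihilated s (insert m M))"
        using S(1) by (intro covered_Union) auto
      then have "covered (G \<inter> annihilated s M)"
        unfolding covered_def using sub_Un by (meson order.trans)
      then show False using M(2) by blast
    qed
    then obtain m where "laurent_monom s m w \<noteq> 1" "\<not> covered (G \<inter> annihilated s (insert m M))"
      by blast
    moreover from this(1) w(1) have "annihilated s (insert m M) \<noteq> annihilated s M"
      by (auto simp: annihilated_def)
    ultimately show ?thesis by blast
  qed
  have "covered G"
  proof (rule ccontr)
    assume not_covered: "\<not> covered G"
    have "\<exists>M. \<forall>k. (finite (M k) \<and> \<not> covered (G \<inter> annihilated s (M k))) \<and>
        (M k \<subseteq> M (Suc k) \<and> annihilated s (M (Suc k)) \<noteq> annihilated s (M k))"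
    proof (rule dependent_nat_choice)
      have "G \<inter> annihilated s {} = G" using sub by (auto simp: annihilated_def)
      then show "\<exists>M. finite M \<and> \<not> covered (G \<inter> annihilated s M)"
        using not_covered by (intro exI[of _ "{}"]) simp
    next
      fix M and k :: nat assume "finite M \<and> \<not> covered (G \<inter> annihilated s M)"
      with refine[of M] obtain m where
        "annihilated s (insert m M) \<noteq> annihilated s M" "\<not> covered (G \<inter> annihilated s (insert m M))"
        by blast
      then show "\<exists>M'. (finite M' \<and> \<not> covered (G \<inter> annihilated s M')) \<and>
          (M \<subseteq> M' \<and> annihilated s M' \<noteq> annihilated s M)"
        using \<open>finite M \<and> _\<close> by (intro exI[of _ "insert m M"]) auto
    qed
    then obtain M where M: "\<And>k. M k \<subseteq> M (Suc k)"
        "\<And>k. annihilated s (M (Suc k)) \<noteq> annihilated s (M k)"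
      by blast
    obtain N where N: "\<And>k. annihilated s (M N) \<subseteq> annihilated s (M k)"
      using annihilated_chain_stabilizes[of M s] M(1) by blast
    have "annihilated s (M (Suc N)) \<subseteq> annihilated s (M N)"
      using M(1)[of N] by (auto simp: annihilated_def)
    then show False using M(2)[of N] N[of "Suc N"] by blast
  qed
  then obtain \<M> where \<M>: "finite \<M>" "\<forall>M\<in>\<M>. finite M \<and> annihilated s M \<subseteq> G"
      "G \<subseteq> (\<Union>M\<in>\<M>. annihilated s M)"
    unfolding covered_def by (elim exE conjE)
  have "G = (\<Union>M\<in>\<M>. annihilated s M)"
    using \<M>(2,3) by (intro equalityI UN_least) simp_all
  then show ?thesis using \<M>(1,2) by (intro exI[of _ \<M>]) simp
qed


section \<open>Computability by exact rational arithmetic\<close>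

lemma rec_eval_Comp1:
  "rec_eval g xs y \<Longrightarrow> rec_eval f [y] z \<Longrightarrow> rec_eval (Comp f [g]) xs z"
  by (rule rec_eval.Comp[where ys = "[y]"]) auto

lemma rec_eval_Comp2:
  "rec_eval g xs y \<Longrightarrow> rec_eval h xs y' \<Longrightarrow> rec_eval f [y, y'] z \<Longrightarrow> rec_eval (Comp f [g, h]) xs z"
  by (rule rec_eval.Comp[where ys = "[y, y']"]) auto

lemma rec_eval_Proj': "i < length xs \<Longrightarrow> xs ! i = y \<Longrightarrow> rec_eval (Proj i) xs y"
  using rec_eval.Proj by blast

lemmas rec_eval_intros =
  rec_eval_Comp1 rec_eval_Comp2 rec_eval_Proj' rec_eval.Zero rec_eval.Succ

definition rec_add :: recf where
  "rec_add = Prec (Proj 0) (Comp Succ [Proj 1])"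
definition rec_mult :: recf where
  "rec_mult = Prec Zero (Comp rec_add [Proj 1, Proj 2])"
definition rec_dec :: recf where
  "rec_dec = Prec Zero (Proj 0)"
definition rec_monus :: recf where
  "rec_monus = Prec (Proj 0) (Comp rec_dec [Proj 1])"
definition rec_not :: recf where
  "rec_not = Prec (Comp Succ [Zero]) Zero"
definition rec_parity :: recf where
  "rec_parity = Prec Zero (Comp rec_not [Proj 1])"
definition rec_half :: recf where
  "rec_half = Prec Zero (Comp rec_add [Proj 1, Comp rec_parity [Proj 0]])"

lemma rec_eval_add: "rec_eval rec_add [m, n] (m + n)"
proof (induction m)
  case 0
  show ?case unfolding rec_add_def by (auto intro!: rec_eval.Prec_0 rec_eval_intros)
next
  case (Suc m)
  then show ?case unfolding rec_add_def
    by (auto intro!: rec_eval.Prec_Suc[where y = "m + n"] rec_eval_intros)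
qed

lemma rec_eval_mult: "rec_eval rec_mult [m, n] (m * n)"
proof (induction m)
  case 0
  show ?case unfolding rec_mult_def by (auto intro!: rec_eval.Prec_0 rec_eval_intros)
next
  case (Suc m)
  have "rec_eval rec_add [m * n, n] (Suc m * n)"
    using rec_eval_add[of "m * n" n] by (simp add: add.commute)
  then show ?case using Suc unfolding rec_mult_def
    by (auto intro!: rec_eval.Prec_Suc[where y = "m * n"] rec_eval_Comp2[where y = "m * n" and y' = n]
        rec_eval_Proj')
qed

lemma rec_eval_dec: "rec_eval rec_dec [m] (m - 1)"
proof (induction m)
  case 0
  show ?case unfolding rec_dec_def by (auto intro!: rec_eval.Prec_0 rec_eval_intros)
next
  case (Suc m)
  then show ?case unfolding rec_dec_def
    by (auto intro!: rec_eval.Prec_Suc[where y = "m - 1"] rec_eval_intros)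
qed

lemma rec_eval_monus: "rec_eval rec_monus [m, n] (n - m)"
proof (induction m)
  case 0
  show ?case unfolding rec_monus_def by (auto intro!: rec_eval.Prec_0 rec_eval_intros)
next
  case (Suc m)
  have "rec_eval rec_dec [n - m] (n - Suc m)"
    using rec_eval_dec[of "n - m"] by simp
  then show ?case using Suc unfolding rec_monus_def
    by (auto intro!: rec_eval.Prec_Suc[where y = "n - m"] rec_eval_Comp1[where y = "n - m"]
        rec_eval_Proj')
qed

lemma rec_eval_not: "rec_eval rec_not [m] (1 - m)"
proof (induction m)
  case 0
  show ?case unfolding rec_not_def
    by (auto intro!: rec_eval.Prec_0 rec_eval_Comp1[where y = 0] rec_eval_intros)
next
  case (Suc m)
  then show ?case unfolding rec_not_def
    by (auto intro!: rec_eval.Prec_Suc[where y = "1 - m"] rec_eval_intros)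
qed

lemma rec_eval_parity: "rec_eval rec_parity [m] (m mod 2)"
proof (induction m)
  case 0
  show ?case unfolding rec_parity_def by (auto intro!: rec_eval.Prec_0 rec_eval_intros)
next
  case (Suc m)
  have "rec_eval rec_not [m mod 2] (Suc m mod 2)"
  proof -
    have "Suc m mod 2 = 1 - m mod 2" by presburger
    then show ?thesis using rec_eval_not[of "m mod 2"] by simp
  qed
  then show ?case using Suc unfolding rec_parity_def
    by (auto intro!: rec_eval.Prec_Suc[where y = "m mod 2"] rec_eval_Comp1[where y = "m mod 2"]
        rec_eval_Proj')
qed

lemma rec_eval_half: "rec_eval rec_half [m] (m div 2)"
proof (induction m)
  case 0
  show ?case unfolding rec_half_def by (auto intro!: rec_eval.Prec_0 rec_eval_intros)
next
  case (Suc m)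
  have "rec_eval rec_add [m div 2, m mod 2] (Suc m div 2)"
  proof -
    have "Suc m div 2 = m div 2 + m mod 2" by presburger
    then show ?thesis using rec_eval_add[of "m div 2" "m mod 2"] by simp
  qed
  then show ?case using Suc rec_eval_parity[of m] unfolding rec_half_def
    by (auto intro!: rec_eval.Prec_Suc[where y = "m div 2"]
        rec_eval_Comp2[where y = "m div 2" and y' = "m mod 2"] rec_eval_Comp1[where y = m] rec_eval_Proj')
qed

definition computable_nat :: "('a \<Rightarrow> nat list) \<Rightarrow> 'a set \<Rightarrow> ('a \<Rightarrow> nat) \<Rightarrow> bool" where
  "computable_nat enc D F \<longleftrightarrow> (\<exists>f. \<forall>x\<in>D. rec_eval f (enc x) (F x))"

lemma computable_nat_Comp1:
  "(\<And>n. rec_eval g [n] (G n)) \<Longrightarrow> computable_nat enc D F \<Longrightarrow> computable_nat enc D (\<lambda>x. G (F x))"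
  unfolding computable_nat_def
proof (elim exE)
  fix f assume "\<And>n. rec_eval g [n] (G n)" "\<forall>x\<in>D. rec_eval f (enc x) (F x)"
  then show "\<exists>f. \<forall>x\<in>D. rec_eval f (enc x) (G (F x))"
    by (intro exI[of _ "Comp g [f]"]) (auto intro: rec_eval_Comp1)
qed

lemma computable_nat_Comp2:
  "(\<And>m n. rec_eval g [m, n] (G m n)) \<Longrightarrow> computable_nat enc D F \<Longrightarrow> computable_nat enc D F' \<Longrightarrow>
    computable_nat enc D (\<lambda>x. G (F x) (F' x))"
  unfolding computable_nat_def
proof (elim exE)
  fix f f' assume "\<And>m n. rec_eval g [m, n] (G m n)" "\<forall>x\<in>D. rec_eval f (enc x) (F x)"
    "\<forall>x\<in>D. rec_eval f' (enc x) (F' x)"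
  then show "\<exists>f. \<forall>x\<in>D. rec_eval f (enc x) (G (F x) (F' x))"
    by (intro exI[of _ "Comp g [f, f']"]) (auto intro: rec_eval_Comp2)
qed

lemma computable_nat_cong:
  "computable_nat enc D F \<Longrightarrow> (\<And>x. x \<in> D \<Longrightarrow> F x = G x) \<Longrightarrow> computable_nat enc D G"
  by (simp add: computable_nat_def)

lemma computable_nat_nth: "(\<And>x. x \<in> D \<Longrightarrow> i < length (enc x)) \<Longrightarrow> computable_nat enc D (\<lambda>x. enc x ! i)"
  unfolding computable_nat_def by (intro exI[of _ "Proj i"] ballI rec_eval.Proj)

lemma computable_nat_const: "computable_nat enc D (\<lambda>_. k)"
proof (induction k)
  case 0
  show ?case unfolding computable_nat_def using rec_eval.Zero by blast
next
  case (Suc k)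
  show ?case by (rule computable_nat_Comp1[OF rec_eval.Succ Suc])
qed

lemmas computable_nat_add = computable_nat_Comp2[OF rec_eval_add]
lemmas computable_nat_mult = computable_nat_Comp2[OF rec_eval_mult]
lemmas computable_nat_monus = computable_nat_Comp2[OF rec_eval_monus]
lemmas computable_nat_parity = computable_nat_Comp1[OF rec_eval_parity]
lemmas computable_nat_half = computable_nat_Comp1[OF rec_eval_half]

text \<open>
  Computability by exact rational arithmetic: the value is a fraction with a computable numerator,
  written as a difference of natural numbers, and a computable positive denominator.
\<close>

definition computable_real :: "('a \<Rightarrow> nat list) \<Rightarrow> 'a set \<Rightarrow> ('a \<Rightarrow> real) \<Rightarrow> bool" where
  "computable_real enc D \<phi> \<longleftrightarrow>
    (\<exists>a b c. computable_nat enc D a \<and> computable_nat enc D b \<and> computable_nat enc D c \<and>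
      (\<forall>x\<in>D. c x > 0 \<and> \<phi> x = (real (a x) - real (b x)) / real (c x)))"

lemma computable_realI:
  assumes "computable_nat enc D a" "computable_nat enc D b" "computable_nat enc D c"
    "\<And>x. x \<in> D \<Longrightarrow> c x > 0" "\<And>x. x \<in> D \<Longrightarrow> \<phi> x = (real (a x) - real (b x)) / real (c x)"
  shows "computable_real enc D \<phi>"
  unfolding computable_real_def using assms by (intro exI[of _ a] exI[of _ b] exI[of _ c]) simp

lemma computable_real_add:
  assumes "computable_real enc D \<phi>" "computable_real enc D \<psi>"
  shows "computable_real enc D (\<lambda>x. \<phi> x + \<psi> x)"
proof -
  obtain a b c where 1: "computable_nat enc D a" "computable_nat enc D b" "computable_nat enc D c"
      "\<forall>x\<in>D. c x > 0 \<and> \<phi> x = (real (a x) - real (b x)) / real (c x)"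
    using assms(1) unfolding computable_real_def by (elim exE conjE)
  obtain a' b' c' where 2: "computable_nat enc D a'" "computable_nat enc D b'" "computable_nat enc D c'"
      "\<forall>x\<in>D. c' x > 0 \<and> \<psi> x = (real (a' x) - real (b' x)) / real (c' x)"
    using assms(2) unfolding computable_real_def by (elim exE conjE)
  show ?thesis
  proof (rule computable_realI)
    show "computable_nat enc D (\<lambda>x. a x * c' x + a' x * c x)"
      by (intro computable_nat_add computable_nat_mult 1 2)
    show "computable_nat enc D (\<lambda>x. b x * c' x + b' x * c x)"
      by (intro computable_nat_add computable_nat_mult 1 2)
    show "computable_nat enc D (\<lambda>x. c x * c' x)"
      by (intro computable_nat_mult 1 2)
  qed (use 1(4) 2(4) in \<open>auto simp: field_simps\<close>)
qed

lemma computable_real_mult: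
  assumes "computable_real enc D \<phi>" "computable_real enc D \<psi>"
  shows "computable_real enc D (\<lambda>x. \<phi> x * \<psi> x)"
proof -
  obtain a b c where 1: "computable_nat enc D a" "computable_nat enc D b" "computable_nat enc D c"
      "\<forall>x\<in>D. c x > 0 \<and> \<phi> x = (real (a x) - real (b x)) / real (c x)"
    using assms(1) unfolding computable_real_def by (elim exE conjE)
  obtain a' b' c' where 2: "computable_nat enc D a'" "computable_nat enc D b'" "computable_nat enc D c'"
      "\<forall>x\<in>D. c' x > 0 \<and> \<psi> x = (real (a' x) - real (b' x)) / real (c' x)"
    using assms(2) unfolding computable_real_def by (elim exE conjE)
  show ?thesis
  proof (rule computable_realI)
    show "computable_nat enc D (\<lambda>x. a x * a' x + b x * b' x)"
      by (intro computable_nat_add computable_nat_mult 1 2)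
    show "computable_nat enc D (\<lambda>x. a x * b' x + b x * a' x)"
      by (intro computable_nat_add computable_nat_mult 1 2)
    show "computable_nat enc D (\<lambda>x. c x * c' x)"
      by (intro computable_nat_mult 1 2)
  qed (use 1(4) 2(4) in \<open>auto simp: field_simps\<close>)
qed

lemma computable_real_of_int: "computable_real enc D (\<lambda>_. of_int k)"
  by (rule computable_realI[where a = "\<lambda>_. nat k" and b = "\<lambda>_. nat (- k)" and c = "\<lambda>_. 1"])
    (auto intro: computable_nat_const)

lemma computable_real_uminus: "computable_real enc D \<phi> \<Longrightarrow> computable_real enc D (\<lambda>x. - \<phi> x)"
  using computable_real_mult[OF computable_real_of_int[of enc D "-1"]] by simp

lemma computable_real_diff:
  "computable_real enc D \<phi> \<Longrightarrow> computable_real enc D \<psi> \<Longrightarrow> computable_real enc D (\<lambda>x. \<phi> x - \<psi> x)"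
  using computable_real_add[OF _ computable_real_uminus] by fastforce

text \<open>With truncated subtraction, \<open>a = b\<close> if and only if \<open>(a - b) + (b - a) = 0\<close>.\<close>

lemma decidable_on_computable_real_eq_0:
  assumes "computable_real enc D \<phi>"
  shows "decidable_on enc D (\<lambda>x. \<phi> x = 0)"
proof -
  obtain a b c where 1: "computable_nat enc D a" "computable_nat enc D b"
      "\<forall>x\<in>D. c x > 0 \<and> \<phi> x = (real (a x) - real (b x)) / real (c x)"
    using assms unfolding computable_real_def by (elim exE conjE)
  have "computable_nat enc D (\<lambda>x. 1 - ((a x - b x) + (b x - a x)))"
    by (intro computable_nat_monus computable_nat_add computable_nat_const 1)
  then have "computable_nat enc D (\<lambda>x. if \<phi> x = 0 then 1 else 0)"
    by (rule computable_nat_cong) (use 1(3) in auto)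
  then show ?thesis by (simp add: computable_nat_def decidable_on_def)
qed

definition computable_complex :: "('a \<Rightarrow> nat list) \<Rightarrow> 'a set \<Rightarrow> ('a \<Rightarrow> complex) \<Rightarrow> bool" where
  "computable_complex enc D \<phi> \<longleftrightarrow>
    computable_real enc D (\<lambda>x. Re (\<phi> x)) \<and> computable_real enc D (\<lambda>x. Im (\<phi> x))"

lemma computable_complex_add:
  "computable_complex enc D \<phi> \<Longrightarrow> computable_complex enc D \<psi> \<Longrightarrow> computable_complex enc D (\<lambda>x. \<phi> x + \<psi> x)"
  by (simp add: computable_complex_def computable_real_add)

lemma computable_complex_diff:
  "computable_complex enc D \<phi> \<Longrightarrow> computable_complex enc D \<psi> \<Longrightarrow> computable_complex enc D (\<lambda>x. \<phi> x - \<psi> x)"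
  by (simp add: computable_complex_def computable_real_diff)

lemma computable_complex_mult:
  "computable_complex enc D \<phi> \<Longrightarrow> computable_complex enc D \<psi> \<Longrightarrow> computable_complex enc D (\<lambda>x. \<phi> x * \<psi> x)"
  by (simp add: computable_complex_def computable_real_add computable_real_diff computable_real_mult)

lemma computable_complex_cnj: "computable_complex enc D \<phi> \<Longrightarrow> computable_complex enc D (\<lambda>x. cnj (\<phi> x))"
  by (simp add: computable_complex_def computable_real_uminus)

lemma computable_complex_of_int: "computable_complex enc D (\<lambda>_. of_int k)"
  using computable_real_of_int[of enc D k] computable_real_of_int[of enc D 0]
  by (simp add: computable_complex_def)

lemma computable_complex_sum:
  "finite I \<Longrightarrow> (\<And>i. i \<in> I \<Longrightarrow> computable_complex enc D (\<phi> i)) \<Longrightarrow>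
    computable_complex enc D (\<lambda>x. \<Sum>i\<in>I. \<phi> i x)"
proof (induction I rule: finite_induct)
  case empty
  show ?case using computable_complex_of_int[of enc D 0] by simp
qed (simp add: computable_complex_add)

lemma computable_complex_cong:
  "computable_complex enc D \<phi> \<Longrightarrow> (\<And>x. x \<in> D \<Longrightarrow> \<phi> x = \<psi> x) \<Longrightarrow> computable_complex enc D \<psi>"
  by (simp add: computable_complex_def computable_real_def)

text \<open>
  The code of an integer is even for nonnegative and odd for negative integers, so parity and half
  of the code give the positive and the negative part of the numerator.
\<close>

lemma computable_real_encoded:
  assumes "\<And>x. x \<in> D \<Longrightarrow> \<phi> x \<in> \<rat> \<and> Suc i < length (enc x) \<and> encode_rational (\<phi> x) = [enc x ! i, enc x ! Suc i]"
  shows "computable_real enc D \<phi>"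
proof (rule computable_realI)
  let ?p = "\<lambda>x. enc x ! i"
  have p: "computable_nat enc D ?p" using assms by (intro computable_nat_nth) (auto dest: Suc_lessD)
  show "computable_nat enc D (\<lambda>x. (?p x div 2) * (1 - ?p x mod 2))"
    by (intro computable_nat_mult computable_nat_half computable_nat_monus computable_nat_parity
        computable_nat_const p)
  show "computable_nat enc D (\<lambda>x. (?p x div 2 + 1) * (?p x mod 2))"
    by (intro computable_nat_mult computable_nat_add computable_nat_half computable_nat_parity
        computable_nat_const p)
  show "computable_nat enc D (\<lambda>x. enc x ! Suc i)"
    using assms by (intro computable_nat_nth) auto
  fix x assume x: "x \<in> D"
  then obtain r where r: "\<phi> x = of_rat r" using assms by (meson Rats_cases)
  obtain n d where nd: "quotient_of r = (n, d)" by fastforce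
  have d: "d > 0" using nd by (rule quotient_of_denom_pos)
  have enc: "?p x = int_encode n" "enc x ! Suc i = nat d"
    using assms[OF x] encode_rational_of_rat[of r] by (simp_all add: r nd)
  show "enc x ! Suc i > 0" using enc d by simp
  have "of_int n = real (?p x div 2 * (1 - ?p x mod 2)) - real ((?p x div 2 + 1) * (?p x mod 2))"
    unfolding enc int_encode_def sum_encode_def by (auto simp: mod_Suc)
  then show "\<phi> x = (real (?p x div 2 * (1 - ?p x mod 2)) - real ((?p x div 2 + 1) * (?p x mod 2)))
      / real (enc x ! Suc i)"
    using d enc quotient_of_div[OF nd] by (simp add: r of_rat_divide)
qed

lemma nth_concat_equal_lengths:
  assumes "\<And>xs. xs \<in> set xss \<Longrightarrow> length xs = k" "i < length xss" "j < k"
  shows "concat xss ! (i * k + j) = xss ! i ! j"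
  using assms
proof (induction xss arbitrary: i)
  case (Cons xs xss)
  then show ?case by (cases i) (auto simp: nth_append)
qed simp

lemma length_concat_equal_lengths:
  "(\<And>xs. xs \<in> set xss \<Longrightarrow> length xs = k) \<Longrightarrow> length (concat xss) = length xss * k"
  by (induction xss) auto

lemma encode_mat_nth:
  assumes A: "A \<in> carrier_mat r c" and ij: "i < r" "j < c" and t: "t < 4"
  shows "encode_mat A ! ((i * c + j) * 4 + t) = encode_gaussian (A $$ (i, j)) ! t"
    and "(i * c + j) * 4 + t < length (encode_mat A)"
proof -
  have rows: "\<And>xs. xs \<in> set (mat_to_list A) \<Longrightarrow> length xs = c" "length (mat_to_list A) = r"
    using A by (auto simp: mat_to_list_def)
  have len: "length (concat (mat_to_list A)) = r * c"
    using length_concat_equal_lengths[of "mat_to_list A" c] rows by simp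
  have lt: "i * c + j < r * c"
  proof -
    have "i * c + j < (i + 1) * c" using ij(2) by simp
    also have "\<dots> \<le> r * c" using ij(1) by (intro mult_right_mono) auto
    finally show ?thesis .
  qed
  have 4: "length xs = 4" if "xs \<in> set (map encode_gaussian (concat (mat_to_list A)))" for xs
    using that length_encode_gaussian by auto
  have "concat (mat_to_list A) ! (i * c + j) = A $$ (i, j)"
    using nth_concat_equal_lengths[of "mat_to_list A" c i j] rows A ij by (simp add: mat_to_list_def)
  then show "encode_mat A ! ((i * c + j) * 4 + t) = encode_gaussian (A $$ (i, j)) ! t"
    unfolding encode_mat_def
    using nth_concat_equal_lengths[of "map encode_gaussian (concat (mat_to_list A))" 4 "i * c + j" t, OF 4] lt t len
    by simp
  show "(i * c + j) * 4 + t < length (encode_mat A)"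
    unfolding encode_mat_def
    using length_concat_equal_lengths[of "map encode_gaussian (concat (mat_to_list A))" 4, OF 4] lt t len
    by simp
qed

lemma computable_entry:
  assumes D: "D \<subseteq> {A \<in> carrier_mat r c. elements_mat A \<subseteq> gaussian_rationals}" and ij: "i < r" "j < c"
  shows "computable_complex encode_mat D (\<lambda>A. A $$ (i, j))"
proof -
  have rat: "Re (A $$ (i, j)) \<in> \<rat> \<and> Im (A $$ (i, j)) \<in> \<rat>" if "A \<in> D" for A
  proof -
    have "A $$ (i, j) \<in> elements_mat A" using D that ij by (intro elements_matI[of A r c i j]) auto
    then show ?thesis using D that by (auto simp: gaussian_rationals_def)
  qed
  have two: "\<exists>a b. encode_rational x = [a, b]" for x
    by (simp add: encode_rational_def split_beta)
  have enc: "encode_rational (Re (A $$ (i, j))) = [encode_mat A ! ((i * c + j) * 4), encode_mat A ! Suc ((i * c + j) * 4)]"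
     "encode_rational (Im (A $$ (i, j))) = [encode_mat A ! ((i * c + j) * 4 + 2), encode_mat A ! Suc ((i * c + j) * 4 + 2)]"
     "(i * c + j) * 4 + 3 < length (encode_mat A)" if "A \<in> D" for A
  proof -
    have A: "A \<in> carrier_mat r c" using D that by auto
    obtain a b a' b' where ab: "encode_rational (Re (A $$ (i, j))) = [a, b]"
       "encode_rational (Im (A $$ (i, j))) = [a', b']" using two by metis
    note nth = encode_mat_nth(1)[OF A ij]
    show "(i * c + j) * 4 + 3 < length (encode_mat A)"
      by (rule encode_mat_nth(2)[OF A ij]) simp
    show "encode_rational (Re (A $$ (i, j))) = [encode_mat A ! ((i * c + j) * 4), encode_mat A ! Suc ((i * c + j) * 4)]"
     "encode_rational (Im (A $$ (i, j))) = [encode_mat A ! ((i * c + j) * 4 + 2), encode_mat A ! Suc ((i * c + j) * 4 + 2)]"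
      using nth[of 0] nth[of 1] nth[of 2] nth[of 3]
      by (simp_all add: ab encode_gaussian_def numeral_2_eq_2 numeral_3_eq_3)
  qed
  define k where "k = (i * c + j) * 4"
  note enc = enc[folded k_def]
  have "computable_real encode_mat D (\<lambda>A. Re (A $$ (i, j)))"
    by (rule computable_real_encoded[where i = k]) (use enc(1,3) rat Suc_lessD in fastforce)
  moreover have "computable_real encode_mat D (\<lambda>A. Im (A $$ (i, j)))"
    by (rule computable_real_encoded[where i = "k + 2"]) (use enc(2,3) rat in \<open>simp add: numeral_3_eq_3\<close>)
  ultimately show ?thesis by (simp add: computable_complex_def)
qed

lemma computable_moment:
  assumes D: "D \<subseteq> {A \<in> carrier_mat n n. elements_mat A \<subseteq> gaussian_rationals}"
  shows "computable_complex encode_mat D (moment k)"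
proof -
  have carr: "A \<in> carrier_mat n n" if "A \<in> D" for A using D that by auto
  have pow: "computable_complex encode_mat D (\<lambda>A. (A ^\<^sub>m k) $$ (i, j))" if "i < n" "j < n" for i j
    using that
  proof (induction k arbitrary: i j)
    case 0
    have "computable_complex encode_mat D (\<lambda>A. of_int (if i = j then 1 else 0))"
      by (rule computable_complex_of_int)
    then show ?case
      by (rule computable_complex_cong) (use 0 in \<open>auto dest!: carr\<close>)
  next
    case (Suc k)
    have "computable_complex encode_mat D (\<lambda>A. \<Sum>l<n. (A ^\<^sub>m k) $$ (i, l) * A $$ (l, j))"
      using Suc by (intro computable_complex_sum computable_complex_mult computable_entry[OF D]) auto
    then show ?case
    proof (rule computable_complex_cong)
      fix A assume "A \<in> D"
      then have "A \<in> carrier_mat n n" "A ^\<^sub>m k \<in> carrier_mat n n" using carr by auto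
      then show "(\<Sum>l<n. (A ^\<^sub>m k) $$ (i, l) * A $$ (l, j)) = (A ^\<^sub>m Suc k) $$ (i, j)"
        using Suc.prems by (simp add: scalar_prod_def lessThan_atLeast0)
    qed
  qed
  have "computable_complex encode_mat D (\<lambda>A. \<Sum>i<n. (A ^\<^sub>m k) $$ (i, i))"
    using pow by (intro computable_complex_sum) auto
  then show ?thesis
    by (rule computable_complex_cong) (auto dest!: carr simp: moment_def mat_trace_def)
qed


section \<open>Symmetric Laurent polynomials and power sums\<close>

text \<open>The injective maps from \<open>{..<n}\<close> to \<open>{..<s}\<close>, as lists; for \<open>n = s\<close> these are the permutations.\<close>

definition arrangements :: "nat \<Rightarrow> nat \<Rightarrow> nat list set" where
  "arrangements n s = {is. length is = n \<and> distinct is \<and> set is \<subseteq> {..<s}}"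

lemma finite_arrangements: "finite (arrangements n s)"
  by (rule finite_subset[OF _ finite_lists_length_eq[of "{..<s}" n]]) (auto simp: arrangements_def)

lemma arrangements_Suc:
  "arrangements (Suc n) s = (\<lambda>(is, i). i # is) ` (SIGMA is : arrangements n s. {..<s} - set is)"
proof (intro equalityI subsetI)
  fix ks assume "ks \<in> arrangements (Suc n) s"
  then obtain i js where "ks = i # js" "length js = n" "distinct (i # js)" "set (i # js) \<subseteq> {..<s}"
    by (cases ks) (auto simp: arrangements_def)
  then have "(js, i) \<in> (SIGMA is : arrangements n s. {..<s} - set is)" "ks = (\<lambda>(is, i). i # is) (js, i)"
    by (auto simp: arrangements_def)
  then show "ks \<in> (\<lambda>(is, i). i # is) ` (SIGMA is : arrangements n s. {..<s} - set is)" by blast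
qed (auto simp: arrangements_def)

text \<open>
  For \<open>length es = s\<close> this is a monomial with exponents \<open>es\<close>, summed over all permutations of the
  variables. Shorter lists of exponents make the recursion below possible.
\<close>

definition arrangement_sum :: "nat \<Rightarrow> int list \<Rightarrow> (nat \<Rightarrow> complex) \<Rightarrow> complex" where
  "arrangement_sum s es x =
    (\<Sum>is\<in>arrangements (length es) s. \<Prod>t<length es. x (is ! t) powi (es ! t))"

lemma arrangement_sum_Nil: "arrangement_sum s [] x = 1"
proof -
  have "arrangements 0 s = {[]}" by (auto simp: arrangements_def)
  then show ?thesis by (simp add: arrangement_sum_def)
qed

text \<open>
  The index for the new exponent \<open>e\<close> ranges over all indices but those already in use. The sum over
  all indices gives the power sum; for an index in use, the two powers of the same variable merge.
\<close>

lemma arrangement_sum_Cons: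
  assumes x: "\<And>i. i < s \<Longrightarrow> x i \<noteq> 0"
  shows "arrangement_sum s (e # es) x =
    (\<Sum>i<s. x i powi e) * arrangement_sum s es x -
    (\<Sum>t<length es. arrangement_sum s (es[t := es ! t + e]) x)"
proof -
  let ?A = "arrangements (length es) s"
  define P where "P es is = (\<Prod>t<length es. x (is ! t) powi (es ! t))" for es :: "int list" and "is" :: "nat list"
  have P_update: "P es is * x (is ! t) powi e = P (es[t := es ! t + e]) is"
    if "is \<in> ?A" "t < length es" for "is" t
  proof -
    have "is ! t < s" using that by (auto simp: arrangements_def subset_iff)
    then have "x (is ! t) powi (es ! t + e) = x (is ! t) powi (es ! t) * x (is ! t) powi e"
      using x by (simp add: power_int_add)
    then show ?thesis
      using that(2) by (simp add: P_def prod.remove[of "{..<length es}" t])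
  qed
  have "arrangement_sum s (e # es) x =
      (\<Sum>(is, i)\<in>(SIGMA is : ?A. {..<s} - set is). P (e # es) (i # is))"
    unfolding arrangement_sum_def P_def[symmetric] unfolding length_Cons arrangements_Suc
    by (subst sum.reindex) (auto simp: inj_on_def case_prod_unfold)
  also have "\<dots> = (\<Sum>is\<in>?A. \<Sum>i\<in>{..<s} - set is. P es is * x i powi e)"
    by (subst sum.Sigma) (auto simp: finite_arrangements P_def prod.lessThan_Suc_shift mult.commute
        simp del: prod.lessThan_Suc)
  also have "\<dots> = (\<Sum>is\<in>?A. P es is * (\<Sum>i<s. x i powi e) - (\<Sum>t<length es. P es is * x (is ! t) powi e))"
  proof (intro sum.cong refl)
    fix "is" assume "is \<in> ?A"
    then have is': "length is = length es" "distinct is" "set is \<subseteq> {..<s}" by (auto simp: arrangements_def)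
    have "bij_betw ((!) is) {..<length es} (set is)"
      using is' by (intro bij_betw_nth) auto
    then have "(\<Sum>i\<in>set is. x i powi e) = (\<Sum>t<length es. x (is ! t) powi e)"
      by (rule sum.reindex_bij_betw[symmetric])
    moreover have "(\<Sum>i\<in>{..<s} - set is. x i powi e) = (\<Sum>i<s. x i powi e) - (\<Sum>i\<in>set is. x i powi e)"
      using is' by (intro sum_diff) auto
    ultimately show "(\<Sum>i\<in>{..<s} - set is. P es is * x i powi e) =
        P es is * (\<Sum>i<s. x i powi e) - (\<Sum>t<length es. P es is * x (is ! t) powi e)"
      by (simp add: right_diff_distrib flip: sum_distrib_left)
  qed
  also have "\<dots> = (\<Sum>is\<in>?A. P es is * (\<Sum>i<s. x i powi e)) -
      (\<Sum>t<length es. \<Sum>is\<in>?A. P es is * x (is ! t) powi e)"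
    unfolding sum_subtractf by (subst (2) sum.swap) (rule refl)
  also have "(\<Sum>t<length es. \<Sum>is\<in>?A. P es is * x (is ! t) powi e) =
      (\<Sum>t<length es. \<Sum>is\<in>?A. P (es[t := es ! t + e]) is)"
    using P_update by (intro sum.cong refl) auto
  finally have eq: "arrangement_sum s (e # es) x = (\<Sum>is\<in>?A. P es is * (\<Sum>i<s. x i powi e)) -
      (\<Sum>t<length es. \<Sum>is\<in>?A. P (es[t := es ! t + e]) is)" .
  have "(\<Sum>is\<in>?A. P es is * (\<Sum>i<s. x i powi e)) = (\<Sum>i<s. x i powi e) * arrangement_sum s es x"
    unfolding sum_distrib_right[symmetric] arrangement_sum_def P_def by (rule mult.commute)
  moreover have "(\<Sum>t<length es. \<Sum>is\<in>?A. P (es[t := es ! t + e]) is) =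
      (\<Sum>t<length es. arrangement_sum s (es[t := es ! t + e]) x)"
    by (simp add: arrangement_sum_def P_def)
  ultimately show ?thesis unfolding eq by (simp only:)
qed

lemma computable_arrangement_sum:
  assumes nonzero: "\<And>a i. a \<in> D \<Longrightarrow> i < s \<Longrightarrow> x a i \<noteq> 0"
    and power_sums: "\<And>e. computable_complex enc D (\<lambda>a. \<Sum>i<s. x a i powi e)"
  shows "computable_complex enc D (\<lambda>a. arrangement_sum s es (x a))"
proof (induction "length es" arbitrary: es)
  case 0
  then show ?case
    using computable_complex_of_int[of enc D 1] by (simp add: arrangement_sum_Nil)
next
  case (Suc n)
  then obtain e es' where es: "es = e # es'" "length es' = n" by (cases es) auto
  have "computable_complex enc D (\<lambda>a. (\<Sum>i<s. x a i powi e) * arrangement_sum s es' (x a) -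
      (\<Sum>t<length es'. arrangement_sum s (es'[t := es' ! t + e]) (x a)))"
    using Suc.hyps(1) es(2)
    by (intro computable_complex_diff computable_complex_mult computable_complex_sum power_sums) auto
  then show ?case unfolding es(1)
    by (rule computable_complex_cong) (subst arrangement_sum_Cons, auto simp: nonzero)
qed

text \<open>
  Functions that agree on the torus with a Laurent polynomial with integer coefficients. Only the
  values on the torus count, since negative exponents express complex conjugation there.
\<close>

inductive laurent_poly :: "nat \<Rightarrow> ((nat \<Rightarrow> complex) \<Rightarrow> complex) \<Rightarrow> bool" for s where
  monom: "(\<And>z. z \<in> torus s \<Longrightarrow> f z = of_int c * laurent_monom s m z) \<Longrightarrow> laurent_poly s f"
| add: "laurent_poly s f \<Longrightarrow> laurent_poly s g \<Longrightarrow> (\<And>z. z \<in> torus s \<Longrightarrow> h z = f z + g z) \<Longrightarrow> laurent_poly s h"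

lemma laurent_poly_const: "laurent_poly s (\<lambda>_. of_int c)"
  by (rule laurent_poly.monom[where c = c and m = "\<lambda>_. 0"]) (simp add: laurent_monom_def)

lemma laurent_poly_mult_monom:
  "laurent_poly s f \<Longrightarrow> (\<And>z. z \<in> torus s \<Longrightarrow> h z = f z * (of_int c * laurent_monom s m z)) \<Longrightarrow> laurent_poly s h"
proof (induction arbitrary: h rule: laurent_poly.induct)
  case (monom f c' m')
  show ?case
    by (rule laurent_poly.monom[where c = "c' * c" and m = "\<lambda>j. m' j + m j"])
      (simp add: monom laurent_monom_add)
next
  case (add f g k)
  show ?case
    by (rule laurent_poly.add[OF add.IH(1)[where h = "\<lambda>z. f z * (of_int c * laurent_monom s m z)"]
          add.IH(2)[where h = "\<lambda>z. g z * (of_int c * laurent_monom s m z)"]])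
      (simp_all add: add.hyps add.prems distrib_right)
qed

lemma laurent_poly_mult:
  assumes "laurent_poly s f" "laurent_poly s g"
  shows "laurent_poly s (\<lambda>z. f z * g z)"
proof -
  have "laurent_poly s h" if "laurent_poly s g" "\<And>z. z \<in> torus s \<Longrightarrow> h z = f z * g z" for g h
    using that
  proof (induction arbitrary: h rule: laurent_poly.induct)
    case (monom g c m)
    show ?case by (rule laurent_poly_mult_monom[OF assms(1), of h c m]) (simp add: monom)
  next
    case (add g g' k)
    show ?case
      by (rule laurent_poly.add[OF add.IH(1)[where h = "\<lambda>z. f z * g z"] add.IH(2)[where h = "\<lambda>z. f z * g' z"]])
        (simp_all add: add.hyps add.prems distrib_left)
  qed
  from this[OF assms(2)] show ?thesis by simp
qed

lemma laurent_poly_sum: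
  "finite I \<Longrightarrow> (\<And>i. i \<in> I \<Longrightarrow> laurent_poly s (f i)) \<Longrightarrow> laurent_poly s (\<lambda>z. \<Sum>i\<in>I. f i z)"
proof (induction I rule: finite_induct)
  case empty
  show ?case using laurent_poly_const[of s 0] by simp
next
  case (insert i I)
  then show ?case
    by (auto intro: laurent_poly.add[of s "f i" "\<lambda>z. \<Sum>i\<in>I. f i z"])
qed

lemma laurent_poly_prod:
  "finite I \<Longrightarrow> (\<And>i. i \<in> I \<Longrightarrow> laurent_poly s (f i)) \<Longrightarrow> laurent_poly s (\<lambda>z. \<Prod>i\<in>I. f i z)"
proof (induction I rule: finite_induct)
  case empty
  show ?case using laurent_poly_const[of s 1] by simp
qed (simp add: laurent_poly_mult)

text \<open>For \<open>|u| = 1\<close> one has \<open>|u - 1|\<^sup>2 = 2 - u - 1/u\<close>.\<close>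

lemma laurent_poly_dist_square:
  "laurent_poly s (\<lambda>z. of_real ((norm (laurent_monom s m z - 1))\<^sup>2))"
proof (rule laurent_poly.add)
  show "laurent_poly s (\<lambda>z. of_int 2)" by (rule laurent_poly_const)
  show "laurent_poly s (\<lambda>z. of_int (-1) * laurent_monom s m z + of_int (-1) * laurent_monom s (\<lambda>j. - m j) z)"
    by (rule laurent_poly.add[OF laurent_poly.monom[where c = "-1" and m = m]
          laurent_poly.monom[where c = "-1" and m = "\<lambda>j. - m j"]]) auto
  fix z assume z: "z \<in> torus s"
  have "laurent_monom s m z * cnj (laurent_monom s m z) = 1"
    using norm_laurent_monom[OF z, of m] by (simp flip: complex_norm_square)
  then show "of_real ((norm (laurent_monom s m z - 1))\<^sup>2) =
      of_int 2 + (of_int (-1) * laurent_monom s m z + of_int (-1) * laurent_monom s (\<lambda>j. - m j) z)"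
    using z by (simp add: complex_norm_square cnj_laurent_monom algebra_simps del: of_real_power)
qed

lemma arrangement_torus:
  "is \<in> arrangements s s \<Longrightarrow> z \<in> torus s \<Longrightarrow> (\<lambda>j. z (is ! j)) \<in> torus s"
  by (auto simp: arrangements_def torus_def subset_iff)

text \<open>
  Symmetric Laurent polynomials are polynomials in power sums, so they can be computed although the
  points \<open>x a\<close> themselves (later: the eigenvalues) are not accessible to exact rational arithmetic.
\<close>

lemma computable_symmetrization:
  assumes torus: "\<And>a. a \<in> D \<Longrightarrow> x a \<in> torus s"
    and power_sums: "\<And>e. computable_complex enc D (\<lambda>a. \<Sum>i<s. x a i powi e)"
    and f: "laurent_poly s f"
  shows "computable_complex enc D (\<lambda>a. \<Sum>is\<in>arrangements s s. f (\<lambda>j. x a (is ! j)))"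
  using f
proof induction
  case (monom f c m)
  have "computable_complex enc D (\<lambda>a. of_int c * arrangement_sum s (map m [0..<s]) (x a))"
    by (intro computable_complex_mult computable_complex_of_int computable_arrangement_sum power_sums)
      (rule torus_nonzero[OF torus])
  then show ?case
  proof (rule computable_complex_cong)
    fix a assume "a \<in> D"
    then have "f (\<lambda>j. x a (is ! j)) = of_int c * laurent_monom s m (\<lambda>j. x a (is ! j))"
      if "is \<in> arrangements s s" for "is"
      using that by (intro monom arrangement_torus torus)
    then show "of_int c * arrangement_sum s (map m [0..<s]) (x a) =
        (\<Sum>is\<in>arrangements s s. f (\<lambda>j. x a (is ! j)))"
      by (simp add: arrangement_sum_def laurent_monom_def sum_distrib_left)
  qed
next
  case (add f g h)
  from computable_complex_add[OF add.IH] show ?case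
  proof (rule computable_complex_cong)
    fix a assume "a \<in> D"
    then have "h (\<lambda>j. x a (is ! j)) = f (\<lambda>j. x a (is ! j)) + g (\<lambda>j. x a (is ! j))"
      if "is \<in> arrangements s s" for "is"
      using that by (intro add.hyps arrangement_torus torus)
    then show "(\<Sum>is\<in>arrangements s s. f (\<lambda>j. x a (is ! j))) +
        (\<Sum>is\<in>arrangements s s. g (\<lambda>j. x a (is ! j))) =
        (\<Sum>is\<in>arrangements s s. h (\<lambda>j. x a (is ! j)))"
      by (simp add: sum.distrib)
  qed
qed


section \<open>Moments of unitary matrices as power sums\<close>

lemma mat_trace_mult_commute:
  assumes "A \<in> carrier_mat n n" "B \<in> carrier_mat n n"
  shows "mat_trace (A * B) = mat_trace (B * A)"
proof -
  have "mat_trace (A * B) = (\<Sum>i<n. \<Sum>j<n. A $$ (i, j) * B $$ (j, i))"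
    using assms by (auto simp: mat_trace_def scalar_prod_def lessThan_atLeast0 intro!: sum.cong)
  also have "\<dots> = (\<Sum>j<n. \<Sum>i<n. B $$ (j, i) * A $$ (i, j))"
    by (subst sum.swap) (simp add: mult.commute)
  also have "\<dots> = mat_trace (B * A)"
    using assms by (auto simp: mat_trace_def scalar_prod_def lessThan_atLeast0 intro!: sum.cong)
  finally show ?thesis .
qed

lemma upper_triangular_pow:
  assumes B: "B \<in> carrier_mat n n" and ut: "upper_triangular B"
  shows "upper_triangular (B ^\<^sub>m k) \<and> (\<forall>i<n. (B ^\<^sub>m k) $$ (i, i) = (B $$ (i, i)) ^ k)"
proof (induction k)
  case 0
  then show ?case using B by auto
next
  case (Suc k)
  have Bk: "B ^\<^sub>m k \<in> carrier_mat n n" using B by simp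
  have zero: "(B ^\<^sub>m k) $$ (i, j) = 0" if "j < i" "i < n" for i j
    using Suc that Bk by (auto dest!: upper_triangularD)
  have zero': "B $$ (i, j) = 0" if "j < i" "i < n" for i j
    using ut that B by (auto dest!: upper_triangularD)
  have entry: "(B ^\<^sub>m Suc k) $$ (i, j) = (\<Sum>l<n. (B ^\<^sub>m k) $$ (i, l) * B $$ (l, j))"
    if "i < n" "j < n" for i j
    using that B Bk by (simp add: scalar_prod_def lessThan_atLeast0)
  have "(B ^\<^sub>m Suc k) $$ (i, j) = 0" if "j < i" "i < n" for i j
  proof -
    have "(B ^\<^sub>m k) $$ (i, l) * B $$ (l, j) = 0" if "l < n" for l
      using zero[of l i] zero'[of j l] that \<open>j < i\<close> \<open>i < n\<close> by (cases "l < i") auto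
    then show ?thesis using entry[of i j] that by simp
  qed
  moreover have "(B ^\<^sub>m Suc k) $$ (i, i) = (B $$ (i, i)) ^ Suc k" if "i < n" for i
  proof -
    have "(B ^\<^sub>m k) $$ (i, l) * B $$ (l, i) = 0" if "l < n" "l \<noteq> i" for l
      using zero[of l i] zero'[of i l] that \<open>i < n\<close> by (cases "l < i") auto
    then have "(\<Sum>l<n. (B ^\<^sub>m k) $$ (i, l) * B $$ (l, i)) = (B ^\<^sub>m k) $$ (i, i) * B $$ (i, i)"
      using that by (subst sum.remove[of _ i]) (auto intro: sum.neutral)
    then show ?thesis using entry[of i i] that Suc by (simp add: power_commutes)
  qed
  ultimately show ?case using B by (auto intro!: upper_triangularI simp del: pow_mat.simps)
qed

text \<open>An eigenvector \<open>v\<close> satisfies \<open>|v|\<^sup>2 = |A v|\<^sup>2 = |e|\<^sup>2 |v|\<^sup>2\<close>, because \<open>A\<close> preserves norms.\<close>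

lemma unitary_eigenvalue_norm:
  assumes A: "A \<in> carrier_mat n n" and U: "unitary_mat A" and e: "eigenvalue A e"
  shows "norm e = 1"
proof -
  obtain v where v: "v \<in> carrier_vec n" "v \<noteq> 0\<^sub>v n" "A *\<^sub>v v = e \<cdot>\<^sub>v v"
    using e A by (auto simp: eigenvalue_def eigenvector_def)
  define N where "N = (\<Sum>i<n. (norm (v $ i))\<^sup>2)"
  have adj: "mat_adjoint A \<in> carrier_mat n n" using A by (auto simp: mat_adjoint_def)
  have adj_entry: "mat_adjoint A $$ (i, j) = cnj (A $$ (j, i))" if "i < n" "j < n" for i j
    using A that by (simp add: mat_adjoint_def mat_of_rows_index conjugate_complex_def)
  have Av: "(\<Sum>j<n. A $$ (i, j) * v $ j) = e * v $ i" if "i < n" for i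
    using arg_cong[OF v(3), of "\<lambda>w. w $ i"] A v(1) that
    by (simp add: scalar_prod_def lessThan_atLeast0)
  have "mat_adjoint A *\<^sub>v (e \<cdot>\<^sub>v v) = v"
  proof -
    have "mat_adjoint A *\<^sub>v (e \<cdot>\<^sub>v v) = (mat_adjoint A * A) *\<^sub>v v"
      using adj A v(1) by (simp add: v(3)[symmetric])
    also have "\<dots> = v" using U A v(1) by (simp add: unitary_mat_def)
    finally show ?thesis .
  qed
  then have adj_v: "v $ i = (\<Sum>j<n. cnj (A $$ (j, i)) * (e * v $ j))" if "i < n" for i
  proof -
    have "v $ i = (mat_adjoint A *\<^sub>v (e \<cdot>\<^sub>v v)) $ i" using \<open>_ = v\<close> by simp
    also have "\<dots> = (\<Sum>j<n. mat_adjoint A $$ (i, j) * (e * v $ j))"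
      using adj v(1) that by (simp add: scalar_prod_def lessThan_atLeast0)
    also have "\<dots> = (\<Sum>j<n. cnj (A $$ (j, i)) * (e * v $ j))"
      using adj_entry that by (intro sum.cong) auto
    finally show ?thesis .
  qed
  have "of_real N = (\<Sum>i<n. cnj (v $ i) * v $ i)"
    by (simp add: N_def complex_norm_square mult.commute del: of_real_power)
  also have "\<dots> = (\<Sum>i<n. cnj (v $ i) * (\<Sum>j<n. cnj (A $$ (j, i)) * (e * v $ j)))"
    by (intro sum.cong refl arg_cong2[of _ _ _ _ "(*)"] adj_v) simp
  also have "\<dots> = (\<Sum>j<n. (\<Sum>i<n. cnj (A $$ (j, i) * v $ i)) * (e * v $ j))"
    unfolding sum_distrib_left sum_distrib_right by (subst sum.swap) (simp add: mult_ac)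
  also have "\<dots> = (\<Sum>j<n. cnj (e * v $ j) * (e * v $ j))"
    by (intro sum.cong refl) (simp only: cnj_sum[symmetric] Av lessThan_iff)
  also have "\<dots> = of_real ((norm e)\<^sup>2) * of_real N"
    by (simp add: N_def complex_norm_square sum_distrib_left mult_ac del: of_real_power)
  finally have "of_real N = (of_real ((norm e)\<^sup>2 * N) :: complex)" by simp
  then have "N = (norm e)\<^sup>2 * N" by (simp only: of_real_eq_iff)
  moreover have "N \<noteq> 0"
  proof
    assume "N = 0"
    then have "v $ i = 0" if "i < n" for i
      using that by (auto simp: N_def sum_nonneg_eq_0_iff)
    then have "v = 0\<^sub>v n" using v(1) by (intro eq_vecI) auto
    then show False using v(2) by contradiction
  qed
  ultimately have "(norm e)\<^sup>2 = 1" by simp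
  then show ?thesis by (simp add: power2_eq_imp_eq)
qed

text \<open>The eigenvalues are the diagonal entries of a triangular matrix similar to \<open>A\<close>.\<close>

lemma unitary_moments_power_sums:
  assumes A: "A \<in> carrier_mat n n" and U: "unitary_mat A"
  shows "\<exists>x\<in>torus n. \<forall>k. moment k A = (\<Sum>i<n. x i ^ k)"
proof -
  obtain es where es: "char_poly A = (\<Prod>e\<leftarrow>es. [:- e, 1:])"
    using char_poly_factorized[OF A] by blast
  obtain B P Q where "schur_decomposition A es = (B, P, Q)" by (cases "schur_decomposition A es")
  from schur_decomposition[OF A es this]
  have wit: "similar_mat_wit A B P Q" and ut: "upper_triangular B" and diag: "diag_mat B = es"
    by auto
  from similar_mat_witD2[OF A wit]
  have PQ: "P \<in> carrier_mat n n" "Q \<in> carrier_mat n n" "B \<in> carrier_mat n n" "Q * P = 1\<^sub>m n"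
    by auto
  define x where "x i = B $$ (i, i)" for i
  have "moment k A = (\<Sum>i<n. x i ^ k)" for k
  proof -
    have Bk: "B ^\<^sub>m k \<in> carrier_mat n n" using PQ by simp
    have "moment k A = mat_trace (P * B ^\<^sub>m k * Q)"
      by (simp add: moment_def similar_mat_wit_pow_id[OF wit])
    also have "\<dots> = mat_trace (Q * (P * B ^\<^sub>m k))"
      using PQ Bk by (intro mat_trace_mult_commute) auto
    also have "Q * (P * B ^\<^sub>m k) = B ^\<^sub>m k"
      using PQ Bk assoc_mult_mat[OF PQ(2,1) Bk] by simp
    finally show ?thesis
      using upper_triangular_pow[OF PQ(3) ut] PQ(3) by (simp add: mat_trace_def x_def)
  qed
  moreover have "x \<in> torus n"
    unfolding torus_def
  proof (intro CollectI allI impI)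
    fix i assume "i < n"
    then have "x i \<in> set es" using PQ(3) by (auto simp: x_def diag[symmetric] diag_mat_def)
    then have "poly (char_poly A) (x i) = 0"
      unfolding es by (induction es) auto
    then show "norm (x i) = 1"
      using unitary_eigenvalue_norm[OF A U] eigenvalue_root_char_poly[OF A] by blast
  qed
  ultimately show ?thesis by blast
qed


section \<open>Deciding moment positivity\<close>

definition nonneg_power_sums :: "nat \<Rightarrow> (nat \<Rightarrow> complex) set" where
  "nonneg_power_sums s = {z \<in> torus s. \<forall>n. (\<Sum>i<s. z i ^ n) \<in> \<real>\<^sub>\<ge>\<^sub>0}"

lemma nonneg_power_sums_finite_union:
  "\<exists>\<M>. finite \<M> \<and> (\<forall>M\<in>\<M>. finite M) \<and> nonneg_power_sums s = (\<Union>M\<in>\<M>. annihilated s M)"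
proof (rule closed_power_closed_finite_union)
  show "nonneg_power_sums s \<subseteq> torus s" by (auto simp: nonneg_power_sums_def)
next
  fix z n assume "z \<in> nonneg_power_sums s"
  then show "(\<lambda>j. z j ^ n) \<in> nonneg_power_sums s"
    by (auto simp: nonneg_power_sums_def torus_power simp flip: power_mult)
next
  fix w assume w: "w \<in> torus s"
    and near: "\<And>d. d > 0 \<Longrightarrow> \<exists>z\<in>nonneg_power_sums s. \<forall>j<s. norm (z j - w j) < d"
  have "\<forall>k. \<exists>z. z \<in> nonneg_power_sums s \<and> (\<forall>j<s. norm (z j - w j) < inverse (real (Suc k)))"
    using near by (metis inverse_positive_iff_positive of_nat_0_less_iff zero_less_Suc)
  then obtain z where z: "\<And>k. z k \<in> nonneg_power_sums s"
      "\<And>k j. j < s \<Longrightarrow> norm (z k j - w j) < inverse (real (Suc k))"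
    by metis
  have lim: "(\<lambda>k. z k j) \<longlonglongrightarrow> w j" if "j < s" for j
  proof (rule LIM_zero_cancel, rule Lim_null_comparison)
    show "\<forall>\<^sub>F k in sequentially. norm (z k j - w j) \<le> inverse (real (Suc k))"
      using z(2)[OF that] by (auto intro: less_imp_le always_eventually)
    show "(\<lambda>k. inverse (real (Suc k))) \<longlonglongrightarrow> 0" by (rule LIMSEQ_inverse_real_of_nat)
  qed
  have "(\<Sum>i<s. w i ^ n) \<in> \<real>\<^sub>\<ge>\<^sub>0" for n
  proof (rule closed_sequentially[OF closed_nonneg_Reals_complex])
    show "(\<lambda>k. \<Sum>i<s. z k i ^ n) \<longlonglongrightarrow> (\<Sum>i<s. w i ^ n)"
      by (intro tendsto_sum tendsto_power lim) simp
    show "(\<Sum>i<s. z k i ^ n) \<in> \<real>\<^sub>\<ge>\<^sub>0" for k using z(1)[of k] by (simp add: nonneg_power_sums_def)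
  qed
  then show "w \<in> nonneg_power_sums s" using w by (simp add: nonneg_power_sums_def)
qed

text \<open>Permuting the coordinates does not change the power sums.\<close>

lemma nonneg_power_sums_arrangement:
  assumes "is \<in> arrangements s s" "z \<in> torus s"
  shows "(\<lambda>j. z (is ! j)) \<in> nonneg_power_sums s \<longleftrightarrow> z \<in> nonneg_power_sums s"
proof -
  have is': "length is = s" "distinct is" "set is \<subseteq> {..<s}" using assms(1) by (auto simp: arrangements_def)
  then have "set is = {..<s}" by (intro card_subset_eq) (auto simp: distinct_card)
  then have "bij_betw ((!) is) {..<s} {..<s}" using is' by (intro bij_betw_nth) auto
  then have "(\<Sum>j<s. z (is ! j) ^ n) = (\<Sum>i<s. z i ^ n)" for n
    by (rule sum.reindex_bij_betw)
  then show ?thesis using assms arrangement_torus by (auto simp: nonneg_power_sums_def)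
qed

lemma laurent_poly_nonneg_power_sums:
  "\<exists>r. laurent_poly s (\<lambda>z. of_real (r z)) \<and> (\<forall>z. r z \<ge> (0 :: real)) \<and>
    (\<forall>z\<in>torus s. r z = 0 \<longleftrightarrow> z \<in> nonneg_power_sums s)"
proof -
  obtain \<M> where \<M>: "finite \<M>" "\<And>M. M \<in> \<M> \<Longrightarrow> finite M"
      "nonneg_power_sums s = (\<Union>M\<in>\<M>. annihilated s M)"
    using nonneg_power_sums_finite_union[of s] by (elim exE conjE) simp
  define r where "r z = (\<Prod>M\<in>\<M>. \<Sum>m\<in>M. (norm (laurent_monom s m z - 1))\<^sup>2)" for z
  have "laurent_poly s (\<lambda>z. of_real (r z))"
    unfolding r_def of_real_prod of_real_sum
    by (intro laurent_poly_prod laurent_poly_sum laurent_poly_dist_square \<M>)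
  moreover have "r z \<ge> 0" for z by (simp add: r_def prod_nonneg sum_nonneg)
  moreover have "r z = 0 \<longleftrightarrow> z \<in> nonneg_power_sums s" if "z \<in> torus s" for z
  proof -
    have "(\<Sum>m\<in>M. (norm (laurent_monom s m z - 1))\<^sup>2) = 0 \<longleftrightarrow> z \<in> annihilated s M" if "M \<in> \<M>" for M
      using \<M>(2)[OF that] \<open>z \<in> torus s\<close> by (simp add: sum_nonneg_eq_0_iff annihilated_def)
    then show ?thesis using \<M>(1) by (auto simp: r_def \<M>(3))
  qed
  ultimately show ?thesis by blast
qed

lemma unit_circle_powi_uminus: "norm (u :: complex) = 1 \<Longrightarrow> u powi (- int n) = cnj (u ^ n)"
proof -
  assume "norm u = 1"
  then have "u * cnj u = 1" by (simp flip: complex_norm_square)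
  then have "inverse u = cnj u" by (metis inverse_unique)
  then show ?thesis by (simp add: power_int_minus power_inverse[symmetric])
qed

theorem corollary11:
  fixes s :: nat
  assumes "s \<ge> 1"
  shows "moment_positivity_decidable \<real>\<^sub>\<ge>\<^sub>0 (unitary_gaussian s)"
proof -
  define D where "D = unitary_gaussian s"
  have D: "D \<subseteq> {A \<in> carrier_mat s s. elements_mat A \<subseteq> gaussian_rationals}"
    by (auto simp: D_def unitary_gaussian_def)
  have "\<forall>A\<in>D. \<exists>x\<in>torus s. \<forall>k. moment k A = (\<Sum>i<s. x i ^ k)"
    by (auto simp: D_def unitary_gaussian_def intro!: unitary_moments_power_sums)
  then obtain x where x: "\<And>A. A \<in> D \<Longrightarrow> x A \<in> torus s"
      "\<And>A k. A \<in> D \<Longrightarrow> moment k A = (\<Sum>i<s. x A i ^ k)"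
    by metis
  have power_sums: "computable_complex encode_mat D (\<lambda>A. \<Sum>i<s. x A i powi e)" for e
  proof (cases e rule: int_cases2)
    case (nonneg n)
    show ?thesis
      by (rule computable_complex_cong[OF computable_moment[OF D, of n]]) (simp add: nonneg x)
  next
    case (nonpos n)
    show ?thesis
      by (rule computable_complex_cong[OF computable_complex_cnj[OF computable_moment[OF D, of n]]])
        (use x in \<open>auto simp: nonpos torus_def unit_circle_powi_uminus intro!: sum.cong\<close>)
  qed
  obtain r where r: "laurent_poly s (\<lambda>z. of_real (r z))" "\<And>z. r z \<ge> (0 :: real)"
      "\<And>z. z \<in> torus s \<Longrightarrow> r z = 0 \<longleftrightarrow> z \<in> nonneg_power_sums s"
    using laurent_poly_nonneg_power_sums[of s] by blast
  \<comment> \<open>As \<open>r\<close> is nonnegative and vanishes either at all or at none of the permuted points, \<open>R\<close> has the same zeros as \<open>r\<close> at \<open>x A\<close>.\<close>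
  define R where "R A = (\<Sum>is\<in>arrangements s s. r (\<lambda>j. x A (is ! j)))" for A
  have "computable_complex encode_mat D (\<lambda>A. \<Sum>is\<in>arrangements s s. of_real (r (\<lambda>j. x A (is ! j))))"
    by (rule computable_symmetrization[OF x(1) power_sums r(1)])
  then have "computable_real encode_mat D R"
    by (simp add: computable_complex_def R_def[abs_def])
  then have dec: "decidable_on encode_mat D (\<lambda>A. R A = 0)"
    by (rule decidable_on_computable_real_eq_0)
  have "R A = 0 \<longleftrightarrow> (\<forall>n. moment n A \<in> \<real>\<^sub>\<ge>\<^sub>0)" if A: "A \<in> D" for A
  proof -
    have "[0..<s] \<in> arrangements s s" by (auto simp: arrangements_def)
    then have nonempty: "arrangements s s \<noteq> {}" by blast
    have "R A = 0 \<longleftrightarrow> (\<forall>is\<in>arrangements s s. r (\<lambda>j. x A (is ! j)) = 0)"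
      unfolding R_def by (intro sum_nonneg_eq_0_iff finite_arrangements r(2))
    also have "\<dots> \<longleftrightarrow> (\<forall>is\<in>arrangements s s. x A \<in> nonneg_power_sums s)"
      using x(1)[OF A] by (intro ball_cong refl)
        (simp add: r(3)[OF arrangement_torus] nonneg_power_sums_arrangement)
    also have "\<dots> \<longleftrightarrow> x A \<in> nonneg_power_sums s" using nonempty by blast
    also have "\<dots> \<longleftrightarrow> (\<forall>n. moment n A \<in> \<real>\<^sub>\<ge>\<^sub>0)"
      using x[OF A] by (simp add: nonneg_power_sums_def)
    finally show ?thesis .
  qed
  then show ?thesis
    using dec by (simp add: moment_positivity_decidable_def decidable_on_def D_def)
qed

end
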